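(* Let $c$ be a standard Coxeter element of $W$. Then $\mathbf M(\underline x,y,z)=\mathbf I(\underline x,y+z,z)$, where $$\mathbf I(\underline x,y,z)=\sum_{\substack{\alpha,\beta\in NC(W,c)\\ \alpha\ll\beta}}\Big(\prod_{s\in S\setminus\mathrm{supp}(\beta)}x_s\Big)y^{\mathrm{rk}(\alpha)}z^{\mathrm{rk}(\beta)-\mathrm{rk}(\alpha)},$$ $$\mathbf M(\underline x,y,z)=\sum_{\substack{\alpha,\beta\in NC(W,c)\\ \alpha\le\beta}}\mu(\alpha,\beta)\Big(\prod_{s\in S\setminus\mathrm{supp}(\beta)}x_s\Big)y^{\mathrm{rk}(\alpha)}(-z)^{\mathrm{rk}(\beta)-\mathrm{rk}(\alpha)},$$ and $\mu$ is the Möbius function of $(NC(W,c),\le)$.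
   Context: Let $W$ be a finite real reflection group with simple system of reflections $S$, set of reflections $T$, Coxeter length $\ell$; $(x_s)_{s\in S}$ are variables. $\mathrm{supp}(w)$ is the set of simple reflections occurring in a reduced expression of $w$. Absolute length $\ell_T(w)$: minimal number of reflections with product $w$; $\mathrm{rk}=\ell_T$; absolute order $v\le w$ iff $\ell_T(w)=\ell_T(v)+\ell_T(v^{-1}w)$; $v\lessdot w$ means $v\le w$ and $\ell_T(v)=\ell_T(w)-1$; $\ll$ is the reflexive-transitive closure of "$v\lessdot w$ and $\ell(w)<\ell(v)$". A standard Coxeter element is a product of all elements of $S$, each once, in some order; $NC(W,c)=\{w:w\le c\}$. *)

theory Defs
  imports "HOL-Analysis.Analysis"
begin

section \<open>Finite real reflection groups\<close>

text \<open>
  A finite real reflection group is a set \<open>W\<close> of maps on a Euclidean space; its product is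
  composition. Reflections are involutions, so the group they generate is the set of all finite
  products, without formal inverses.
\<close>

definition refl_along :: "'a::euclidean_space \<Rightarrow> 'a \<Rightarrow> 'a" where
  "refl_along a v = v - (2 * (v \<bullet> a) / (a \<bullet> a)) *\<^sub>R a"

definition word_prod :: "('a \<Rightarrow> 'a) list \<Rightarrow> 'a \<Rightarrow> 'a" where
  "word_prod ws = foldr (\<circ>) ws id"

definition finite_reflection_group :: "('a::euclidean_space \<Rightarrow> 'a) set \<Rightarrow> bool" where
  "finite_reflection_group W \<longleftrightarrow>
     finite W \<and> (\<exists>A \<subseteq> {refl_along a |a. a \<noteq> 0}. W = {word_prod ws |ws. set ws \<subseteq> A})"

definition reflections :: "('a::euclidean_space \<Rightarrow> 'a) set \<Rightarrow> ('a \<Rightarrow> 'a) set" where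
  "reflections W = {refl_along a |a. a \<noteq> 0 \<and> refl_along a \<in> W}"

text \<open>
  The root system of \<open>W\<close> is normalised to unit vectors. Rescaling roots by positive factors in a
  \<open>W\<close>-invariant way rescales simple roots accordingly and does not change the simple reflections.
\<close>

definition roots :: "('a::euclidean_space \<Rightarrow> 'a) set \<Rightarrow> 'a set" where
  "roots W = {a. norm a = 1 \<and> refl_along a \<in> W}"

definition simple_roots :: "('a::euclidean_space \<Rightarrow> 'a) set \<Rightarrow> 'a set \<Rightarrow> bool" where
  "simple_roots W \<Delta> \<longleftrightarrow> \<Delta> \<subseteq> roots W \<and> independent \<Delta> \<and>
     (\<forall>a \<in> roots W. \<exists>k. (\<forall>d\<in>\<Delta>. 0 \<le> k d) \<and>
        (a = (\<Sum>d\<in>\<Delta>. k d *\<^sub>R d) \<or> a = - (\<Sum>d\<in>\<Delta>. k d *\<^sub>R d)))"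

definition simple_system :: "('a::euclidean_space \<Rightarrow> 'a) set \<Rightarrow> ('a \<Rightarrow> 'a) set \<Rightarrow> bool" where
  "simple_system W S \<longleftrightarrow> (\<exists>\<Delta>. simple_roots W \<Delta> \<and> S = refl_along ` \<Delta>)"


section \<open>Lengths, support and orders\<close>

text \<open>
  \<open>word_length A w\<close> is the Coxeter length for \<open>A = S\<close> and the absolute length for
  \<open>A = reflections W\<close>. It is unspecified when \<open>w\<close> is not a product of elements of \<open>A\<close>.
\<close>

definition word_length :: "('a \<Rightarrow> 'a) set \<Rightarrow> ('a \<Rightarrow> 'a) \<Rightarrow> nat" where
  "word_length A w = (LEAST n. \<exists>ws. set ws \<subseteq> A \<and> word_prod ws = w \<and> length ws = n)"

definition reduced_word :: "('a \<Rightarrow> 'a) set \<Rightarrow> ('a \<Rightarrow> 'a) \<Rightarrow> ('a \<Rightarrow> 'a) list \<Rightarrow> bool" where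
  "reduced_word S w ws \<longleftrightarrow> set ws \<subseteq> S \<and> word_prod ws = w \<and> length ws = word_length S w"

definition supp :: "('a \<Rightarrow> 'a) set \<Rightarrow> ('a \<Rightarrow> 'a) \<Rightarrow> ('a \<Rightarrow> 'a) set" where
  "supp S w = {s. \<exists>ws. reduced_word S w ws \<and> s \<in> set ws}"

definition rk :: "('a::euclidean_space \<Rightarrow> 'a) set \<Rightarrow> ('a \<Rightarrow> 'a) \<Rightarrow> nat" where
  "rk W w = word_length (reflections W) w"

definition abs_le :: "('a::euclidean_space \<Rightarrow> 'a) set \<Rightarrow> ('a \<Rightarrow> 'a) \<Rightarrow> ('a \<Rightarrow> 'a) \<Rightarrow> bool" where
  "abs_le W v w \<longleftrightarrow> v \<in> W \<and> w \<in> W \<and> rk W w = rk W v + rk W (inv v \<circ> w)"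

definition abs_cover :: "('a::euclidean_space \<Rightarrow> 'a) set \<Rightarrow> ('a \<Rightarrow> 'a) \<Rightarrow> ('a \<Rightarrow> 'a) \<Rightarrow> bool" where
  "abs_cover W v w \<longleftrightarrow> abs_le W v w \<and> rk W w = rk W v + 1"

definition ll :: "('a::euclidean_space \<Rightarrow> 'a) set \<Rightarrow> ('a \<Rightarrow> 'a) set \<Rightarrow>
    ('a \<Rightarrow> 'a) \<Rightarrow> ('a \<Rightarrow> 'a) \<Rightarrow> bool" where
  "ll W S = (\<lambda>v w. abs_cover W v w \<and> word_length S w < word_length S v)\<^sup>*\<^sup>*"

definition standard_coxeter :: "('a \<Rightarrow> 'a) set \<Rightarrow> ('a \<Rightarrow> 'a) \<Rightarrow> bool" where
  "standard_coxeter S c \<longleftrightarrow> (\<exists>ws. distinct ws \<and> set ws = S \<and> c = word_prod ws)"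

definition NC :: "('a::euclidean_space \<Rightarrow> 'a) set \<Rightarrow> ('a \<Rightarrow> 'a) \<Rightarrow> ('a \<Rightarrow> 'a) set" where
  "NC W c = {w \<in> W. abs_le W w c}"


section \<open>Moebius function of a finite poset\<close>

definition finite_poset :: "'b set \<Rightarrow> ('b \<Rightarrow> 'b \<Rightarrow> bool) \<Rightarrow> bool" where
  "finite_poset P le \<longleftrightarrow> finite P \<and> reflp_on P le \<and> transp_on P le \<and> antisymp_on P le"

function mobius :: "'b set \<Rightarrow> ('b \<Rightarrow> 'b \<Rightarrow> bool) \<Rightarrow> 'b \<Rightarrow> 'b \<Rightarrow> int" where
  "mobius P le x y =
     (if finite_poset P le \<and> x \<in> P \<and> y \<in> P \<and> le x y
      then if x = y then 1 else - (\<Sum>z\<in>{z\<in>P. le x z \<and> le z y \<and> z \<noteq> y}. mobius P le x z)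
      else 0)"
  by pat_completeness auto
termination
proof (relation "Wellfounded.measure (\<lambda>(P, le, x, y). card {u\<in>P. le u y})", goal_cases)
  case (2 P le x y z)
  then have z: "z \<in> P" "le z y" "z \<noteq> y" and y: "y \<in> P" and
    po: "finite P" "reflp_on P le" "transp_on P le" "antisymp_on P le"
    by (auto simp: finite_poset_def)
  have "{u\<in>P. le u z} \<subseteq> {u\<in>P. le u y}"
    using po(3) z y by (auto dest: transp_onD)
  moreover have "\<not> le y z" "le y y" using po z y by (auto dest: antisymp_onD reflp_onD)
  ultimately have "{u\<in>P. le u z} \<subset> {u\<in>P. le u y}" using y by auto
  then show ?case using po(1) by (simp add: psubset_card_mono)
qed simp

declare mobius.simps [simp del]

lemma mobius_sum:
  assumes P: "finite_poset P le" and xy: "x \<in> P" "y \<in> P" "le x y"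
  shows "(\<Sum>z\<in>{z\<in>P. le x z \<and> le z y}. mobius P le x z) = (if x = y then 1 else 0)"
proof (cases "x = y")
  case True
  then have "{z\<in>P. le x z \<and> le z y} = {x}"
    using P xy by (auto simp: finite_poset_def dest: antisymp_onD)
  with True P xy show ?thesis by (simp add: mobius.simps[of P le y y])
next
  case False
  have "{z\<in>P. le x z \<and> le z y} = insert y {z\<in>P. le x z \<and> le z y \<and> z \<noteq> y}"
    using P xy by (auto simp: finite_poset_def dest: reflp_onD)
  then show ?thesis
    using False P xy by (simp add: mobius.simps[of P le x y] finite_poset_def)
qed


section \<open>Absolute order is a partial order\<close>

text \<open>Hence the guard in \<open>mobius\<close> is satisfied for \<open>NC W c\<close>.\<close>

lemma word_prod_simps [simp]:
  "word_prod [] = id" "word_prod (f # ws) = f \<circ> word_prod ws"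
  "word_prod (us @ ws) = word_prod us \<circ> word_prod ws"
proof -
  show "word_prod [] = id" "word_prod (f # ws) = f \<circ> word_prod ws"
    by (simp_all add: word_prod_def)
  show "word_prod (us @ ws) = word_prod us \<circ> word_prod ws"
    by (induction us) (simp_all add: word_prod_def comp_assoc)
qed

lemma refl_along_invol: "refl_along a \<circ> refl_along a = id"
proof
  fix v :: 'a
  show "(refl_along a \<circ> refl_along a) v = id v"
  proof (cases "a = 0")
    case False
    then have "refl_along a v \<bullet> a = - (v \<bullet> a)"
      by (simp add: refl_along_def inner_diff_left)
    then have "refl_along a (refl_along a v) = refl_along a v + (2 * (v \<bullet> a) / (a \<bullet> a)) *\<^sub>R a"
      by (simp add: refl_along_def[of a "refl_along a v"])
    then show ?thesis by (simp add: refl_along_def)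
  qed (simp add: refl_along_def)
qed

lemma word_prod_rev:
  assumes "set ws \<subseteq> {refl_along a |a. a \<noteq> 0}"
  shows "word_prod ws \<circ> word_prod (rev ws) = id"
  using assms
proof (induction ws)
  case (Cons s ws)
  then have "s \<circ> s = id" using refl_along_invol by auto
  moreover have "word_prod ws \<circ> word_prod (rev ws) = id" 
    using Cons.IH Cons.prems by (simp only: list.set insert_subset)
  ultimately have "s (word_prod ws (word_prod (rev ws) (s v))) = v" for v
    by (metis comp_apply id_apply)
  then show ?case by (simp add: fun_eq_iff)
qed simp

lemma finite_reflection_group_words:
  assumes "finite_reflection_group W"
  shows "W = {word_prod ws |ws. set ws \<subseteq> reflections W}"
proof -
  obtain A where A: "A \<subseteq> {refl_along a |a. a \<noteq> 0}" "W = {word_prod ws |ws. set ws \<subseteq> A}"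
    using assms by (auto simp: finite_reflection_group_def)
  have "s \<in> W" if "s \<in> A" for s
    unfolding A(2) using that by (auto intro!: exI[of _ "[s]"])
  then have "A \<subseteq> reflections W" using A(1) by (fastforce simp: reflections_def)
  then have "W \<subseteq> {word_prod ws |ws. set ws \<subseteq> reflections W}" using A(2) by blast
  moreover have comp: "f \<circ> g \<in> W" if "f \<in> W" "g \<in> W" for f g
  proof -
    from that obtain us ws where
      "f = word_prod us" "g = word_prod ws" "set us \<subseteq> A" "set ws \<subseteq> A"
      unfolding A(2) by blast
    then have "f \<circ> g = word_prod (us @ ws)" "set (us @ ws) \<subseteq> A" by simp_all
    then show ?thesis unfolding A(2) by blast
  qed
  have "id \<in> W" unfolding A(2) by (auto intro!: exI[of _ "[]"])
  then have "word_prod ws \<in> W" if "set ws \<subseteq> reflections W" for ws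
    using that by (induction ws) (auto simp: reflections_def intro: comp)
  ultimately show ?thesis by auto
qed

lemma group_closed:
  assumes W: "finite_reflection_group W"
  shows "id \<in> W" "f \<in> W \<Longrightarrow> g \<in> W \<Longrightarrow> f \<circ> g \<in> W" "f \<in> W \<Longrightarrow> bij f" "f \<in> W \<Longrightarrow> inv f \<in> W"
proof -
  note words = finite_reflection_group_words[OF W]
  show "id \<in> W" by (subst words) (auto intro!: exI[of _ "[]"])
  show "f \<circ> g \<in> W" if fg: "f \<in> W" "g \<in> W"
  proof -
    from fg obtain us ws where
      "f = word_prod us" "g = word_prod ws" "set us \<subseteq> reflections W" "set ws \<subseteq> reflections W"
      using words by blast
    then have "f \<circ> g = word_prod (us @ ws)" "set (us @ ws) \<subseteq> reflections W" by simp_all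
    then show ?thesis by (subst words) blast
  qed
  have *: "bij f \<and> inv f \<in> W" if f: "f \<in> W" for f
  proof -
    obtain ws where ws: "f = word_prod ws" "set ws \<subseteq> reflections W"
      using f words by blast
    then have "set ws \<subseteq> {refl_along a |a. a \<noteq> 0}" by (auto simp: reflections_def)
    then have "f \<circ> word_prod (rev ws) = id" "word_prod (rev ws) \<circ> f = id"
      using word_prod_rev[of ws] word_prod_rev[of "rev ws"] ws by simp_all
    moreover from this have "inv f = word_prod (rev ws)"
      by (metis inv_unique_comp)
    moreover have "word_prod (rev ws) \<in> W"
      by (subst words) (use ws(2) in \<open>auto intro!: exI[of _ "rev ws"]\<close>)
    ultimately show ?thesis by (metis o_bij)
  qed
  show "f \<in> W \<Longrightarrow> bij f" "f \<in> W \<Longrightarrow> inv f \<in> W" using * by auto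
qed

lemma rk_word:
  assumes W: "finite_reflection_group W" and w: "w \<in> W"
  obtains ws where "set ws \<subseteq> reflections W" "word_prod ws = w" "length ws = rk W w"
proof -
  let ?P = "\<lambda>n. \<exists>ws. set ws \<subseteq> reflections W \<and> word_prod ws = w \<and> length ws = n"
  have "w \<in> {word_prod ws |ws. set ws \<subseteq> reflections W}"
    using w finite_reflection_group_words[OF W] by simp
  then have "\<exists>n. ?P n" by auto
  then have "?P (LEAST n. ?P n)" by (rule LeastI_ex)
  then show thesis using that by (auto simp: rk_def word_length_def)
qed

lemma rk_le: "set ws \<subseteq> reflections W \<Longrightarrow> rk W (word_prod ws) \<le> length ws"
  unfolding rk_def word_length_def by (rule Least_le) blast

lemma rk_comp_le:
  assumes W: "finite_reflection_group W" and "f \<in> W" "g \<in> W"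
  shows "rk W (f \<circ> g) \<le> rk W f + rk W g"
proof -
  obtain us where us: "set us \<subseteq> reflections W" "word_prod us = f" "length us = rk W f"
    using rk_word[OF W \<open>f \<in> W\<close>] .
  obtain ws where ws: "set ws \<subseteq> reflections W" "word_prod ws = g" "length ws = rk W g"
    using rk_word[OF W \<open>g \<in> W\<close>] .
  show ?thesis using rk_le[of "us @ ws" W] us ws by simp
qed

lemma rk_eq_0: "finite_reflection_group W \<Longrightarrow> w \<in> W \<Longrightarrow> rk W w = 0 \<longleftrightarrow> w = id"
proof
  assume W: "finite_reflection_group W" and w: "w \<in> W" and "rk W w = 0"
  then show "w = id" using rk_word[OF W w] by (metis length_0_conv word_prod_simps(1))
next
  show "w = id \<Longrightarrow> rk W w = 0" using rk_le[of "[]" W] by simp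
qed

lemma finite_poset_NC:
  assumes W: "finite_reflection_group W"
  shows "finite_poset (NC W c) (abs_le W)"
  unfolding finite_poset_def
proof (intro conjI)
  show "finite (NC W c)"
    using W by (simp add: NC_def finite_reflection_group_def)
  have inW: "x \<in> W" if "x \<in> NC W c" for x using that by (simp add: NC_def)
  note grp = group_closed[OF W]
  have bij: "inv f \<circ> f = id" "f \<circ> inv f = id" if "f \<in> W" for f
    using grp(3)[OF that] by (auto simp: bij_def surj_iff)
  show "reflp_on (NC W c) (abs_le W)"
    by (rule reflp_onI) (simp add: abs_le_def inW bij rk_eq_0[OF W grp(1)])
  show "antisymp_on (NC W c) (abs_le W)"
  proof (rule antisymp_onI)
    fix v w assume "v \<in> NC W c" "w \<in> NC W c" and le: "abs_le W v w" "abs_le W w v"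
    then have vw: "v \<in> W" "w \<in> W" using inW by auto
    from le have "rk W (inv v \<circ> w) = 0" by (simp add: abs_le_def)
    then have "inv v \<circ> w = id" using rk_eq_0[OF W] grp vw by simp
    then have "(v \<circ> inv v) \<circ> w = v" by (simp add: comp_assoc)
    then show "v = w" by (simp add: bij(2)[OF vw(1)])
  qed
  show "transp_on (NC W c) (abs_le W)"
  proof (rule transp_onI)
    fix u v w assume le: "abs_le W u v" "abs_le W v w"
    then have uvw: "u \<in> W" "v \<in> W" "w \<in> W" by (auto simp: abs_le_def)
    have "v \<circ> (inv v \<circ> w) = w" "u \<circ> (inv u \<circ> w) = w"
      using uvw by (simp_all add: comp_assoc[symmetric] bij(2))
    then have "(inv u \<circ> v) \<circ> (inv v \<circ> w) = inv u \<circ> w" by (simp add: comp_assoc)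
    then have 1: "rk W (inv u \<circ> w) \<le> rk W (inv u \<circ> v) + rk W (inv v \<circ> w)"
      using rk_comp_le[OF W, of "inv u \<circ> v" "inv v \<circ> w"] grp uvw by simp
    have 2: "rk W w \<le> rk W u + rk W (inv u \<circ> w)"
      using rk_comp_le[OF W, of u "inv u \<circ> w"] grp uvw \<open>u \<circ> (inv u \<circ> w) = w\<close> by simp
    show "abs_le W u w" using 1 2 le uvw by (simp add: abs_le_def)
  qed
qed


section \<open>The polynomials\<close>

text \<open>
  The polynomials have integer coefficients and are rendered by their values at arbitrary
  elements of an arbitrary commutative ring. An identity of such values over all commutative rings
  is the polynomial identity, since the ring may itself be a polynomial ring.
\<close>

definition I_poly :: "('a::euclidean_space \<Rightarrow> 'a) set \<Rightarrow> ('a \<Rightarrow> 'a) set \<Rightarrow> ('a \<Rightarrow> 'a) \<Rightarrow>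
    (('a \<Rightarrow> 'a) \<Rightarrow> 'r) \<Rightarrow> 'r \<Rightarrow> 'r \<Rightarrow> 'r::comm_ring_1" where
  "I_poly W S c x y z =
     (\<Sum>(\<alpha>, \<beta>) \<in> {(\<alpha>, \<beta>). \<alpha> \<in> NC W c \<and> \<beta> \<in> NC W c \<and> ll W S \<alpha> \<beta>}.
        (\<Prod>s \<in> S - supp S \<beta>. x s) * y ^ rk W \<alpha> * z ^ (rk W \<beta> - rk W \<alpha>))"

definition M_poly :: "('a::euclidean_space \<Rightarrow> 'a) set \<Rightarrow> ('a \<Rightarrow> 'a) set \<Rightarrow> ('a \<Rightarrow> 'a) \<Rightarrow>
    (('a \<Rightarrow> 'a) \<Rightarrow> 'r) \<Rightarrow> 'r \<Rightarrow> 'r \<Rightarrow> 'r::comm_ring_1" where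
  "M_poly W S c x y z =
     (\<Sum>(\<alpha>, \<beta>) \<in> {(\<alpha>, \<beta>). \<alpha> \<in> NC W c \<and> \<beta> \<in> NC W c \<and> abs_le W \<alpha> \<beta>}.
        of_int (mobius (NC W c) (abs_le W) \<alpha> \<beta>) *
        (\<Prod>s \<in> S - supp S \<beta>. x s) * y ^ rk W \<alpha> * (- z) ^ (rk W \<beta> - rk W \<alpha>))"

end

(*
  Fix delta <= c. Moebius inversion reduces the theorem to the identity that, summed over all
  beta <= delta with alpha << beta, the sign (-1)^rk(beta) gives (-1)^rk(alpha) if alpha is a subword
  of delta and 0 otherwise; here delta is written as a product of the simple reflections of its
  parabolic subgroup, of which it is a standard Coxeter element, and the subwords of rank k are
  counted by a binomial coefficient. Let kappa be the complement alpha^(-1) delta. If delta makes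
  some root t of the parabolic subgroup of kappa negative, then delta t is delta with one letter
  deleted, and every beta in the sum lies below delta t: induct. Otherwise the sum runs over the
  delta v^(-1) with v a subword of kappa, hence vanishes unless kappa = 1.

  That all elements below a standard Coxeter element are standard Coxeter elements of their
  parabolic subgroups is proved by rotating the Coxeter word.
*)
theory Submission
  imports Defs "HOL-Library.Sublist"
begin

section \<open>Products of reflections\<close>

text \<open>The product of the x_s depends on \<beta> only, so the two polynomials are compared
  separately for each \<beta>, and no support has to be computed. The absolute order is handled by
  linear algebra. A product of reflections in independent roots has the span of these roots as its
  moved space (Carter), so rank is a dimension and a parabolic subsystem is given by its span. The
  recurring tool is the vector f with f - delta^(-1) f = t: it is fixed by delta t, hence orthogonal
  to all roots of the subsystem of which delta t is a Coxeter element. The obstacle is that <<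
  compares lengths in W, while the induction passes to parabolic subsystems. Signs of roots connect
  the two: v t is shorter than v exactly if v makes the positive root t negative, and the positive
  roots of a subsystem are the positive roots of W in its span.\<close>

lemma refl_along_linear: "linear (refl_along a)"
  by (rule linearI) (simp_all add: refl_along_def inner_add_left algebra_simps add_divide_distrib)

lemma refl_along_refl_along [simp]: "refl_along a (refl_along a v) = v"
  using refl_along_invol[of a] by (metis comp_apply id_apply)

lemma refl_along_minus [simp]: "refl_along (- a) = refl_along a"
  by (simp add: refl_along_def fun_eq_iff)

lemma refl_along_inner: "refl_along a v \<bullet> refl_along a w = v \<bullet> w"
proof (cases "a = 0")
  case False
  then show ?thesis
    by (simp add: refl_along_def inner_diff_left inner_diff_right field_simps inner_commute)
qed (simp add: refl_along_def)

lemma refl_along_orthogonal: "orthogonal_transformation (refl_along a)"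
  by (simp add: orthogonal_transformation_def refl_along_linear refl_along_inner)

lemma refl_along_unit: "norm a = 1 \<Longrightarrow> refl_along a v = v - (2 * (v \<bullet> a)) *\<^sub>R a"
  by (simp add: refl_along_def dot_square_norm)

lemma refl_along_self [simp]: "refl_along a a = - a"
  by (cases "a = 0") (simp_all add: refl_along_def scaleR_2)

lemma refl_along_conj:
  assumes "orthogonal_transformation g"
  shows "refl_along (g a) \<circ> g = g \<circ> refl_along a"
proof -
  have g: "linear g" "\<And>v w. g v \<bullet> g w = v \<bullet> w"
    using assms by (auto simp: orthogonal_transformation_def)
  then show ?thesis
    by (auto simp: refl_along_def fun_eq_iff linear_diff linear_scale)
qed

lemma refl_along_eq_iff:
  assumes "norm a = 1" "norm b = 1"
  shows "refl_along a = refl_along b \<longleftrightarrow> a = b \<or> a = - b"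
proof
  assume "refl_along a = refl_along b"
  then have "refl_along b a = - a" by (metis refl_along_self)
  then have "2 *\<^sub>R a = (2 * (a \<bullet> b)) *\<^sub>R b"
    using assms by (simp add: refl_along_unit scaleR_2 algebra_simps)
  then have "a = (a \<bullet> b) *\<^sub>R b" by (metis scaleR_scaleR real_vector.scale_left_imp_eq zero_neq_numeral)
  moreover from this have "\<bar>a \<bullet> b\<bar> = 1" using assms by (metis norm_scaleR mult.right_neutral)
  ultimately show "a = b \<or> a = - b" by (auto simp: abs_if split: if_splits)
qed auto

text \<open>Words are lists of root vectors rather than of reflections, so that a word has a span
  and can be independent.\<close>

definition refl_prod :: "'a::euclidean_space list \<Rightarrow> 'a \<Rightarrow> 'a" where
  "refl_prod qs = word_prod (map refl_along qs)"

lemma refl_prod_simps [simp]: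
  "refl_prod [] = id" "refl_prod (q # qs) = refl_along q \<circ> refl_prod qs" "refl_prod (us @ qs) = refl_prod us \<circ> refl_prod qs"
  by (simp_all add: refl_prod_def)

lemma refl_prod_orthogonal: "orthogonal_transformation (refl_prod qs)"
proof (induction qs)
  case (Cons q qs)
  then show ?case
    unfolding refl_prod_simps by (rule orthogonal_transformation_compose[OF refl_along_orthogonal])
qed (simp add: id_def)

lemma refl_prod_linear: "linear (refl_prod qs)"
  using refl_prod_orthogonal orthogonal_transformation_def by blast

lemma refl_prod_inner [simp]: "refl_prod qs v \<bullet> refl_prod qs w = v \<bullet> w"
  using refl_prod_orthogonal orthogonal_transformation_def by blast

lemma refl_prod_rev [simp]: "refl_prod (rev qs) (refl_prod qs v) = v" "refl_prod qs (refl_prod (rev qs) v) = v"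
proof -
  show *: "refl_prod (rev qs) (refl_prod qs v) = v" for qs :: "'a list" and v
    by (induction qs) auto
  show "refl_prod qs (refl_prod (rev qs) v) = v" using *[of "rev qs"] by simp
qed

lemma refl_prod_rev_comp [simp]: "refl_prod (rev qs) \<circ> refl_prod qs = id" "refl_prod qs \<circ> refl_prod (rev qs) = id"
  by (simp_all add: fun_eq_iff)

lemma inv_refl_prod: "inv (refl_prod qs) = refl_prod (rev qs)"
  by (rule inv_unique_comp) simp_all

lemma refl_prod_conj: "refl_along (refl_prod qs a) \<circ> refl_prod qs = refl_prod qs \<circ> refl_along a"
  by (rule refl_along_conj[OF refl_prod_orthogonal])

lemma refl_prod_map_conj:
  "orthogonal_transformation g \<Longrightarrow> refl_prod (map g qs) \<circ> g = g \<circ> refl_prod qs"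
proof (induction qs)
  case (Cons q qs)
  have "refl_prod (map g (q # qs)) \<circ> g = refl_along (g q) \<circ> (refl_prod (map g qs) \<circ> g)" by (simp add: comp_assoc)
  also have "\<dots> = (refl_along (g q) \<circ> g) \<circ> refl_prod qs" using Cons by (simp only: comp_assoc)
  also have "\<dots> = g \<circ> refl_prod (q # qs)" using refl_along_conj[OF Cons.prems] by (simp add: comp_assoc)
  finally show ?case .
qed simp

section \<open>Moved and fixed spaces of products of reflections\<close>

lemma refl_prod_diff_span: "refl_prod qs v - v \<in> span (set qs)"
proof (induction qs)
  case (Cons q qs)
  have "refl_along q w - w \<in> span (set (q # qs))" for w
    using span_scale[OF span_base[of q "set (q # qs)"], of "- (2 * (w \<bullet> q) / (q \<bullet> q))"]
    by (simp add: refl_along_def)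
  then have "refl_along q (refl_prod qs v) - refl_prod qs v \<in> span (set (q # qs))" .
  moreover have "refl_prod qs v - v \<in> span (set (q # qs))"
    using Cons span_mono[of "set qs" "set (q # qs)"] by auto
  ultimately have "(refl_along q (refl_prod qs v) - refl_prod qs v) + (refl_prod qs v - v) \<in> span (set (q # qs))"
    by (rule span_add)
  then show ?case by simp
qed (simp add: span_zero)

lemma refl_prod_in_span: "set qs \<subseteq> span B \<Longrightarrow> v \<in> span B \<Longrightarrow> refl_prod qs v \<in> span B"
proof -
  assume *: "set qs \<subseteq> span B" "v \<in> span B"
  then have "refl_prod qs v - v \<in> span B"
    using refl_prod_diff_span[of qs v] span_minimal[OF _ subspace_span, of "set qs" B] by auto
  then show ?thesis using *(2) by (metis span_add diff_add_cancel)
qed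

lemma refl_prod_rev_in_span: "set qs \<subseteq> span B \<Longrightarrow> v \<in> span B \<Longrightarrow> refl_prod (rev qs) v \<in> span B"
  by (rule refl_prod_in_span) auto

lemma refl_prod_orth_fixed: "(\<And>q. q \<in> set qs \<Longrightarrow> f \<bullet> q = 0) \<Longrightarrow> refl_prod qs f = f"
  by (induction qs) (auto simp: refl_along_def)

text \<open>If \<open>refl_prod (p # qs)\<close> fixes f, then \<open>refl_prod qs f - f\<close> is
  a multiple of p and lies in the span of qs. Independence makes it zero, and the induction
  continues with qs.\<close>

lemma refl_prod_fixed_orth:
  assumes "distinct qs" "independent (set qs)" "refl_prod qs f = f" "q \<in> set qs"
  shows "f \<bullet> q = 0"
  using assms
proof (induction qs)
  case (Cons p qs)
  have p: "p \<notin> span (set qs)" and ind: "independent (set qs)"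
    using Cons.prems by (auto simp: independent_insert)
  then have p0: "p \<noteq> 0" by (metis span_zero)
  have "refl_along p (refl_prod qs f) = f" using Cons.prems by simp
  then have eq: "refl_prod qs f = refl_along p f" by (metis refl_along_refl_along)
  then have "refl_prod qs f - f = (- (2 * (f \<bullet> p) / (p \<bullet> p))) *\<^sub>R p" by (simp add: refl_along_def)
  then have "(- (2 * (f \<bullet> p) / (p \<bullet> p))) *\<^sub>R p \<in> span (set qs)" using refl_prod_diff_span by metis
  then have "p \<in> span (set qs)" if "f \<bullet> p \<noteq> 0"
    using span_scale[of "(- (2 * (f \<bullet> p) / (p \<bullet> p))) *\<^sub>R p" "set qs"
        "inverse (- (2 * (f \<bullet> p) / (p \<bullet> p)))"] that p0 by simp
  then have "f \<bullet> p = 0" using p by blast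
  moreover from this have "refl_prod qs f = f" using eq by (simp add: refl_along_def)
  ultimately show ?case using Cons ind by auto
qed simp

lemma refl_prod_fixed_zero:
  assumes "distinct qs" "independent (set qs)" "refl_prod qs f = f" "f \<in> span (set qs)"
  shows "f = 0"
proof -
  have "f \<bullet> f = 0"
    by (rule orthogonal_to_span[unfolded orthogonal_def, OF assms(4)])
       (use refl_prod_fixed_orth[OF assms(1-3)] in auto)
  then show ?thesis by simp
qed

text \<open>With w = \<open>refl_prod qs\<close>, the map taking f to f - w^(-1) f preserves the
  span of qs and is injective there, since a fixed vector in the span is orthogonal to itself. By
  dimension it is onto.\<close>

lemma refl_prod_solve:
  assumes "distinct qs" "independent (set qs)" "t \<in> span (set qs)"
  obtains f where "f \<in> span (set qs)" "f - refl_prod (rev qs) f = t"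
proof -
  define g where "g f = f - refl_prod (rev qs) f" for f
  have g: "linear g" unfolding g_def by (intro linear_compose_sub linear_ident refl_prod_linear)
  have sub: "g ` span (set qs) \<subseteq> span (set qs)"
    unfolding g_def by (auto intro!: span_diff refl_prod_rev_in_span intro: span_base)
  have "inj_on g (span (set qs))"
  proof (rule inj_onI)
    fix x y assume xy: "x \<in> span (set qs)" "y \<in> span (set qs)" "g x = g y"
    then have "g (x - y) = 0" using g by (simp add: linear_diff)
    then have "refl_prod (rev qs) (x - y) = x - y" by (simp add: g_def)
    then have "refl_prod qs (x - y) = x - y" by (metis refl_prod_rev(2))
    moreover have "x - y \<in> span (set qs)" using xy by (intro span_diff)
    ultimately have "x - y = 0" by (rule refl_prod_fixed_zero[OF assms(1,2)])
    then show "x = y" by simp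
  qed
  then have "dim (g ` span (set qs)) = dim (span (set qs))"
    using g by (intro dim_image_eq) (simp_all only: span_span)
  then have "g ` span (set qs) = span (set qs)"
    using sub g by (intro subspace_dim_equal linear_subspace_image) auto
  then show thesis using that assms(3) unfolding g_def by (smt (verit) imageE)
qed

text \<open>Since f - t = w^(-1) f has the norm of f, the inner product of f and t is 1/2. Hence the
  reflection in t also sends f to w^(-1) f, so f is the new fixed vector gained by composing w with
  it.\<close>

lemma refl_prod_solve_unit:
  assumes "distinct qs" "independent (set qs)" "t \<in> span (set qs)" "norm t = 1"
  obtains f where "f \<in> span (set qs)" "f - refl_prod (rev qs) f = t" "2 * (f \<bullet> t) = 1"
    "refl_prod qs (refl_along t f) = f"
proof -
  obtain f where f: "f \<in> span (set qs)" "f - refl_prod (rev qs) f = t" using refl_prod_solve[OF assms(1-3)] .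
  then have ft: "f - t = refl_prod (rev qs) f" by (metis add_diff_cancel_left' diff_add_cancel diff_diff_eq2 cancel_ab_semigroup_add_class.diff_right_commute)
  then have "(f - t) \<bullet> (f - t) = f \<bullet> f" by (simp only: refl_prod_inner)
  then have 2: "2 * (f \<bullet> t) = 1"
    using assms(4) by (simp add: inner_diff_left inner_diff_right inner_commute norm_eq_1)
  then have "refl_along t f = refl_prod (rev qs) f" using ft assms(4) by (simp add: refl_along_unit)
  then show thesis using that f 2 by simp
qed

text \<open>The span of an independent word is the moved space of its product, and every word with
  that product has the moved space in its span. Counting dimensions then gives the next two lemmas
  (Carter's lemma).\<close>

lemma refl_prod_span_le:
  assumes "distinct qs" "independent (set qs)" "refl_prod us = refl_prod qs"
  shows "span (set qs) \<subseteq> span (set us)"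
proof
  fix t assume "t \<in> span (set qs)"
  then obtain f where f: "f - refl_prod (rev qs) f = t" using refl_prod_solve[OF assms(1,2)] by blast
  have "refl_prod (rev qs) = refl_prod (rev us)" using assms(3) by (metis inv_refl_prod)
  then have "t = - (refl_prod (rev us) f - f)" using f by simp
  then show "t \<in> span (set us)" using refl_prod_diff_span[of "rev us" f] by (metis set_rev span_neg)
qed

lemma refl_prod_length_le:
  assumes "distinct qs" "independent (set qs)" "refl_prod us = refl_prod qs"
  shows "length qs \<le> length us"
proof -
  have "length qs = dim (span (set qs))"
    using assms by (simp add: dim_eq_card_independent distinct_card)
  also have "\<dots> \<le> dim (span (set us))" using refl_prod_span_le[OF assms] by (rule dim_subset)
  also have "\<dots> \<le> card (set us)" by (simp add: dim_le_card')
  also have "\<dots> \<le> length us" by (rule card_length)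
  finally show ?thesis .
qed

lemma refl_prod_same_length:
  assumes "distinct qs" "independent (set qs)" "refl_prod us = refl_prod qs" "length us = length qs"
  shows "distinct us" "independent (set us)" "span (set us) = span (set qs)"
proof -
  have le: "span (set qs) \<subseteq> span (set us)" by (rule refl_prod_span_le[OF assms(1-3)])
  have q: "length qs = dim (span (set qs))"
    using assms by (simp add: dim_eq_card_independent distinct_card)
  have 1: "dim (span (set qs)) \<le> dim (span (set us))" using le by (rule dim_subset)
  have 2: "dim (span (set us)) \<le> card (set us)" "card (set us) \<le> length us"
    by (simp_all add: dim_le_card' card_length)
  show "distinct us" using 1 2 q assms(4) by (simp add: card_distinct)
  show "independent (set us)"
    using 1 2 q assms(4) by (intro card_le_dim_spanning[of _ "span (set us)"]) (auto simp: span_base)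
  show "span (set us) = span (set qs)"
    using le 1 2 q assms(4) by (intro subspace_dim_equal[symmetric]) auto
qed

section \<open>Nonnegative coordinates and obtuse bases\<close>

lemma representation_nonneg:
  fixes B :: "'a::euclidean_space set"
  assumes "independent B" "finite A" "f ` A \<subseteq> B" "\<And>a. a \<in> A \<Longrightarrow> 0 \<le> k a"
  shows "0 \<le> representation B (\<Sum>a\<in>A. k a *\<^sub>R f a) d"
proof -
  have "representation B (\<Sum>a\<in>A. k a *\<^sub>R f a) d = (\<Sum>a\<in>A. k a * representation B (f a) d)"
    using assms by (subst real_vector.representation_sum)
       (auto simp: real_vector.representation_scale span_base span_scale image_subset_iff)
  also have "\<dots> = (\<Sum>a\<in>A. k a * (if d = f a then 1 else 0))"
    using assms by (intro sum.cong) (auto simp: real_vector.representation_basis image_subset_iff)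
  also have "\<dots> \<ge> 0" using assms by (intro sum_nonneg) auto
  finally show ?thesis .
qed

text \<open>Write p = u - w, where u and w are the positive and negative parts of the coordinates.
  In u . u = u . p + u . w the first term is at most 0 by the condition on p and the second by
  obtuseness, so u = 0.\<close>

lemma obtuse_dominated_nonpos:
  fixes B :: "'a::euclidean_space set"
  assumes B: "finite B" "independent B"
    and obtuse: "\<And>a b. a \<in> B \<Longrightarrow> b \<in> B \<Longrightarrow> a \<noteq> b \<Longrightarrow> a \<bullet> b \<le> 0"
    and p: "p \<in> span B" "\<And>b. b \<in> B \<Longrightarrow> p \<bullet> b \<le> 0"
    and b: "b \<in> B"
  shows "representation B p b \<le> 0"
proof -
  define k where "k = representation B p"
  define u where "u = (\<Sum>d\<in>B. max (k d) 0 *\<^sub>R d)"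
  define w where "w = (\<Sum>d\<in>B. max (- k d) 0 *\<^sub>R d)"
  have "p = (\<Sum>d\<in>B. k d *\<^sub>R d)"
    using real_vector.sum_representation_eq[OF B(2) p(1) B(1)] by (simp add: k_def)
  also have "\<dots> = u - w"
    unfolding u_def w_def sum_subtractf[symmetric] scaleR_left_diff_distrib[symmetric]
    by (intro sum.cong) (auto simp: max_def)
  finally have puw: "u = p + w" by simp
  have "u \<bullet> p = (\<Sum>d\<in>B. max (k d) 0 * (p \<bullet> d))"
    unfolding u_def inner_sum_left by (simp add: inner_commute)
  also have "\<dots> \<le> 0" using p(2) by (intro sum_nonpos) (auto simp: mult_nonneg_nonpos)
  finally have up: "u \<bullet> p \<le> 0" .
  have "u \<bullet> w = (\<Sum>d\<in>B. \<Sum>e\<in>B. max (k d) 0 * max (- k e) 0 * (d \<bullet> e))"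
    unfolding u_def w_def inner_sum_left inner_sum_right
    by (subst sum.swap) (simp add: algebra_simps)
  also have "\<dots> \<le> 0"
  proof (intro sum_nonpos)
    \<comment> \<open>For d = e one of the two maxima is zero, so only obtuse pairs count.\<close>
    fix d e assume "d \<in> B" "e \<in> B"
    then show "max (k d) 0 * max (- k e) 0 * (d \<bullet> e) \<le> 0"
      using obtuse[of d e] by (cases "d = e") (auto simp: max_def mult_nonneg_nonpos mult_nonneg_nonneg)
  qed
  finally have "u \<bullet> u \<le> 0" using up puw by (simp add: inner_add_right)
  then have "u = 0" by (metis inner_gt_zero_iff not_le)
  then have "max (k b) 0 = 0"
    using real_vector.independentD[OF B(2,1) subset_refl, of "\<lambda>d. max (k d) 0" b] b
    unfolding u_def by simp
  then show ?thesis unfolding k_def by (simp add: max_def split: if_splits)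
qed

section \<open>Positive systems and Coxeter words\<close>

text \<open>The axioms only say that P picks one root from each opposite pair in a reflection-closed
  set of unit vectors. Convexity enters through \<open>simple_list\<close>, which ties P to
  nonnegative coordinates, one span at a time.\<close>

locale positive_system =
  fixes P :: "'a::euclidean_space set"
  assumes fin: "finite P"
    and unit: "p \<in> P \<Longrightarrow> norm p = 1"
    and neg: "p \<in> P \<Longrightarrow> - p \<notin> P"
    and refl_closed: "p \<in> P \<Longrightarrow> q \<in> P \<Longrightarrow> refl_along p q \<in> P \<or> - refl_along p q \<in> P"
begin

definition all_roots :: "'a set" where "all_roots = {a. a \<in> P \<or> - a \<in> P}"

text \<open>\<open>simple_list rs\<close>: the list \<open>rs\<close> enumerates the simple roots of the parabolic subsystem of
  all roots in its span, so that \<open>refl_prod rs\<close> is a standard Coxeter element of that subsystem.\<close>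

definition simple_list :: "'a list \<Rightarrow> bool" where
  "simple_list rs \<longleftrightarrow> distinct rs \<and> set rs \<subseteq> P \<and> independent (set rs) \<and>
     (\<forall>p \<in> P \<inter> span (set rs). \<forall>d. 0 \<le> representation (set rs) p d)"

lemma P_all_roots: "p \<in> P \<Longrightarrow> p \<in> all_roots" by (simp add: all_roots_def)

lemma all_roots_unit: "a \<in> all_roots \<Longrightarrow> norm a = 1"
  using unit[of a] unit[of "- a"] by (auto simp: all_roots_def)

lemma P_nonzero: "p \<in> P \<Longrightarrow> p \<noteq> 0"
  using unit by fastforce

lemma all_roots_refl: "a \<in> all_roots \<Longrightarrow> b \<in> all_roots \<Longrightarrow> refl_along a b \<in> all_roots"
  using refl_closed[of a b] refl_closed[of a "-b"] refl_closed[of "-a" b] refl_closed[of "-a" "-b"]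
  by (auto simp: all_roots_def linear_neg[OF refl_along_linear])

lemma refl_prod_all_roots: "set qs \<subseteq> all_roots \<Longrightarrow> a \<in> all_roots \<Longrightarrow> refl_prod qs a \<in> all_roots"
  by (induction qs) (auto intro: all_roots_refl)

lemma all_roots_not_P: "a \<in> all_roots \<Longrightarrow> a \<notin> P \<longleftrightarrow> - a \<in> P"
  using neg by (auto simp: all_roots_def)

lemma simple_list_D:
  assumes "simple_list rs"
  shows "distinct rs" "set rs \<subseteq> P" "independent (set rs)" "set rs \<subseteq> all_roots"
    "p \<in> P \<Longrightarrow> p \<in> span (set rs) \<Longrightarrow> 0 \<le> representation (set rs) p d"
  using assms by (auto simp: simple_list_def all_roots_def)

lemma simple_list_pos_coord:
  assumes "simple_list rs" "a \<in> all_roots" "a \<in> span (set rs)" "0 < representation (set rs) a d"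
  shows "a \<in> P"
proof (rule ccontr)
  assume "a \<notin> P"
  then have "- a \<in> P" using assms(2) by (simp add: all_roots_def)
  then have "0 \<le> representation (set rs) (- a) d" using assms by (intro simple_list_D) (auto intro: span_neg)
  then show False using assms simple_list_D(3)[OF assms(1)]
    by (simp add: real_vector.representation_neg)
qed

text \<open>Roots are unit vectors, so a positive root other than s has a positive coordinate at
  some letter other than s. The reflection changes only the coordinate at s, and one positive
  coordinate is enough for positivity.\<close>

lemma simple_list_refl:
  assumes "simple_list rs" "s \<in> set rs" "p \<in> P" "p \<in> span (set rs)" "p \<noteq> s"
  shows "refl_along s p \<in> P"
proof -
  let ?r = "representation (set rs)"
  have s: "s \<in> P" and ind: "independent (set rs)" using assms simple_list_D by auto
  have "\<exists>d. d \<noteq> s \<and> ?r p d \<noteq> 0"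
  proof (rule ccontr)
    assume "\<not> ?thesis"
    then have 0: "\<And>d. d \<noteq> s \<Longrightarrow> ?r p d = 0" by auto
    have "p = (\<Sum>d\<in>set rs. ?r p d *\<^sub>R d)"
      using real_vector.sum_representation_eq[OF ind assms(4)] by simp
    also have "\<dots> = (\<Sum>d\<in>{s}. ?r p d *\<^sub>R d)"
      using 0 assms(2) by (intro sum.mono_neutral_right) auto
    finally have eq: "p = ?r p s *\<^sub>R s" by simp
    then have "\<bar>?r p s\<bar> = 1" using unit s assms(3) by (metis norm_scaleR mult.right_neutral)
    moreover have "0 \<le> ?r p s" using assms by (intro simple_list_D) auto
    ultimately show False using eq assms(5) by simp
  qed
  then obtain d where d: "d \<noteq> s" "?r p d \<noteq> 0" by blast
  then have pos: "0 < ?r p d" using simple_list_D(5)[OF assms(1,3,4), of d] by simp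
  have sp: "s \<in> span (set rs)" using assms by (simp add: span_base)
  have eq: "refl_along s p = p - (2 * (p \<bullet> s)) *\<^sub>R s" using unit s by (simp add: refl_along_unit)
  have "?r (refl_along s p) d = ?r p d"
    unfolding eq using d assms ind sp
    by (simp add: real_vector.representation_diff real_vector.representation_scale
        real_vector.representation_basis span_scale)
  moreover have "refl_along s p \<in> span (set rs)"
    unfolding eq using assms sp by (simp add: span_diff span_scale)
  ultimately show ?thesis
    using simple_list_pos_coord[OF assms(1) all_roots_refl] pos s assms(3) P_all_roots by metis
qed

text \<open>The root \<open>refl_along a b\<close> is positive, and its coordinate at a is -2 (b .
  a).\<close>

lemma simple_list_obtuse:
  assumes "simple_list rs" "a \<in> set rs" "b \<in> set rs" "a \<noteq> b"
  shows "a \<bullet> b \<le> 0"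
proof -
  let ?r = "representation (set rs)"
  have ab: "a \<in> P" "b \<in> P" and ind: "independent (set rs)" using assms simple_list_D by auto
  have sp: "a \<in> span (set rs)" "b \<in> span (set rs)" using assms by (simp_all add: span_base)
  have "refl_along a b \<in> P" using simple_list_refl[OF assms(1,2)] assms ab sp by blast
  moreover have eq: "refl_along a b = b - (2 * (b \<bullet> a)) *\<^sub>R a" using unit ab by (simp add: refl_along_unit)
  ultimately have "0 \<le> ?r (b - (2 * (b \<bullet> a)) *\<^sub>R a) a"
    using assms(1) sp by (intro simple_list_D(5)) (auto intro: span_diff span_scale)
  also have "\<dots> = - 2 * (b \<bullet> a)"
    using ind sp assms
    by (simp add: real_vector.representation_diff real_vector.representation_scale
        real_vector.representation_basis span_scale)
  finally show ?thesis by (simp add: inner_commute)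
qed

lemma simple_list_sub:
  assumes "simple_list rs" "distinct rs'" "set rs' \<subseteq> set rs"
  shows "simple_list rs'"
proof -
  have ind: "independent (set rs)" using assms simple_list_D by auto
  have "0 \<le> representation (set rs') p d" if p: "p \<in> P" "p \<in> span (set rs')" for p d
  proof -
    have "representation (set rs) p = representation (set rs') p"
      using real_vector.representation_extend[OF ind p(2) assms(3)] .
    moreover have "p \<in> span (set rs)" using p(2) span_mono[OF assms(3)] by blast
    ultimately show ?thesis using simple_list_D(5)[OF assms(1) p(1)] by metis
  qed
  then show ?thesis
    using assms simple_list_D(2)[OF assms(1)] independent_mono[OF ind] by (auto simp: simple_list_def)
qed

section \<open>Deleting and exchanging letters\<close>

lemma simple_list_conj_pos:
  assumes "simple_list rs" "s \<in> set rs" "set a \<subseteq> set rs" "s \<notin> set a"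
  shows "refl_prod a s \<in> P"
proof -
  let ?r = "representation (set rs)"
  have ind: "independent (set rs)" using assms simple_list_D by auto
  have s: "s \<in> span (set rs)" using assms by (simp add: span_base)
  have d: "refl_prod a s - s \<in> span (set a)" by (rule refl_prod_diff_span)
  then have d': "refl_prod a s - s \<in> span (set rs)" using span_mono[OF assms(3)] by blast
  have "?r (refl_prod a s - s) s = representation (set a) (refl_prod a s - s) s"
    using real_vector.representation_extend[OF ind d assms(3)] by simp
  also have "\<dots> = 0" using assms(4) real_vector.representation_ne_zero by blast
  finally have "?r (s + (refl_prod a s - s)) s = 1"
    using real_vector.representation_add[OF ind s d'] real_vector.representation_basis[OF ind assms(2)]
    by (simp add: add.commute)
  then have 1: "?r (refl_prod a s) s = 1" by simp
  have "refl_prod a s \<in> span (set rs)" using span_add[OF s d'] by simp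
  moreover have "refl_prod a s \<in> all_roots" using assms simple_list_D(4)[OF assms(1)] by (intro refl_prod_all_roots) auto
  ultimately show ?thesis using simple_list_pos_coord[OF assms(1), of "refl_prod a s" s] 1 by simp
qed

text \<open>These are the roots attached to the letter s from the left and from the right. As s
  occurs only once, its coordinate in both is 1, hence they are positive. Right multiplication by
  the reflection in \<open>refl_prod (rev b) s\<close> deletes s.\<close>

lemma simple_list_split_pos:
  assumes "simple_list (a @ s # b)"
  shows "refl_prod a s \<in> P" "refl_prod (rev b) s \<in> P" "s \<notin> span (set (a @ b))"
    "refl_prod a s \<in> span (set (a @ s # b))" "refl_prod (rev b) s \<in> span (set (a @ s # b))"
proof -
  note D = simple_list_D[OF assms]
  show "refl_prod a s \<in> P" "refl_prod (rev b) s \<in> P"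
    by (rule simple_list_conj_pos[OF assms]; use D(1) in auto)+
  have "set (a @ s # b) = insert s (set (a @ b))" by auto
  moreover have "s \<notin> set (a @ b)" using D(1) by auto
  ultimately show "s \<notin> span (set (a @ b))" using D(3) by (metis independent_insert)
  have "x \<in> span (set (a @ s # b))" if "x \<in> set (a @ s # b)" for x
    using that by (rule span_base)
  then show "refl_prod a s \<in> span (set (a @ s # b))" "refl_prod (rev b) s \<in> span (set (a @ s # b))"
    by (auto intro!: refl_prod_in_span)
qed

text \<open>Apply the letters to t from right to left. The letter at which the root turns negative
  equals that root, because a simple reflection keeps every other positive root positive; conjugated
  to the right end, this letter is the reflection in t and cancels.\<close>

lemma exchange:
  assumes "simple_list rs" "set qs \<subseteq> set rs" "t \<in> P" "t \<in> span (set rs)" "refl_prod qs t \<notin> P"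
  shows "\<exists>a s b. qs = a @ s # b \<and> refl_prod qs \<circ> refl_along t = refl_prod (a @ b)"
  using assms(2,5)
proof (induction qs)
  case (Cons q qs)
  show ?case
  proof (cases "refl_prod qs t \<in> P")
    case False
    moreover have "set qs \<subseteq> set rs" using Cons.prems by simp
    ultimately obtain a s b where "qs = a @ s # b" "refl_prod qs \<circ> refl_along t = refl_prod (a @ b)"
      using Cons.IH by blast
    then have "q # qs = (q # a) @ s # b" "refl_prod (q # qs) \<circ> refl_along t = refl_prod ((q # a) @ b)"
      by (simp_all only: append_Cons refl_prod_simps(2) comp_assoc)
    then show ?thesis by blast
  next
    case True
    have "refl_prod qs t \<in> span (set rs)"
      using Cons.prems assms by (intro refl_prod_in_span) (auto intro: span_base)
    then have "refl_prod qs t = q" using simple_list_refl[OF assms(1) _ True] Cons.prems by auto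
    then have "refl_along q \<circ> refl_prod qs = refl_prod qs \<circ> refl_along t" using refl_prod_conj[of qs t] by simp
    then have "refl_prod (q # qs) \<circ> refl_along t = refl_along q \<circ> (refl_along q \<circ> refl_prod qs)"
      by (metis refl_prod_simps(2) comp_assoc)
    also have "\<dots> = refl_prod qs" by (simp add: fun_eq_iff)
    finally have "q # qs = [] @ q # qs \<and> refl_prod (q # qs) \<circ> refl_along t = refl_prod ([] @ qs)" by simp
    then show ?thesis by blast
  qed
qed (use assms(3) in simp)

text \<open>A positive root in the span of the image is \<open>refl_along s q\<close> with q in the
  span of rs1. It differs from s, which lies outside that span, so q is positive too and its
  nonnegative coordinates carry over.\<close>

lemma simple_list_map_refl:
  assumes rs: "simple_list rs" "s \<in> set rs" and rs1: "simple_list rs1" "set rs1 \<subseteq> span (set rs)" "s \<notin> span (set rs1)"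
  shows "simple_list (map (refl_along s) rs1)"
proof -
  let ?g = "refl_along s"
  note g = refl_along_linear[of s]
  note D = simple_list_D[OF rs1(1)]
  have inj: "inj_on ?g A" for A by (metis inj_onI refl_along_refl_along)
  have s: "s \<in> P" "s \<in> span (set rs)" using rs simple_list_D by (auto intro: span_base)
  have sub: "span (set rs1) \<subseteq> span (set rs)" using rs1(2) by (simp add: span_minimal)
  have gs: "?g p \<in> span (set rs)" if "p \<in> span (set rs)" for p
    using refl_prod_in_span[of "[s]" "set rs" p] that s by simp
  have ind: "independent (?g ` set rs1)"
    using g inj D(3) by (simp add: linear_independent_injective_image)
  have "?g r \<in> P" if "r \<in> set rs1" for r
    using that rs1 D(2) by (intro simple_list_refl[OF rs]) (auto intro: span_base)
  moreover have "0 \<le> representation (?g ` set rs1) p d" if p: "p \<in> P" "p \<in> span (?g ` set rs1)" for p d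
  proof -
    obtain q where q: "q \<in> span (set rs1)" "p = ?g q"
      using p(2) g by (auto simp: linear_span_image)
    have "p \<noteq> s" using q rs1(3) by (metis refl_along_refl_along refl_along_self span_neg add.inverse_inverse)
    then have "q \<in> P" using simple_list_refl[OF rs p(1)] gs q sub
      by (metis refl_along_refl_along subsetD)
    then have k: "0 \<le> representation (set rs1) q d" for d using simple_list_D(5)[OF rs1(1)] q by blast
    have "p = ?g (\<Sum>r\<in>set rs1. representation (set rs1) q r *\<^sub>R r)"
      using real_vector.sum_representation_eq[OF D(3) q(1)] q(2) by simp
    also have "\<dots> = (\<Sum>r\<in>set rs1. representation (set rs1) q r *\<^sub>R ?g r)"
      using g by (simp add: linear_sum linear_scale)
    finally show ?thesis using representation_nonneg[OF ind _ _ k, of "set rs1" ?g] by simp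
  qed
  ultimately show ?thesis
    using ind inj D(1) by (auto simp: simple_list_def distinct_map)
qed

text \<open>For a root with a negative coordinate, of minimal height, all inner products with the obtuse
  set \<open>s # rs1\<close> are nonpositive, so all its coordinates are nonpositive; but its coordinate
  at \<open>s\<close> is positive.\<close>

lemma simple_list_Cons:
  assumes rs: "simple_list (s # rs)" and rs1: "simple_list rs1" "set rs1 \<subseteq> span (set rs)"
  shows "simple_list (s # rs1)"
proof -
  let ?B = "set (s # rs1)" and ?R = "set (s # rs)"
  note D = simple_list_D[OF rs] and D1 = simple_list_D[OF rs1(1)]
  have sub: "span (set rs1) \<subseteq> span (set rs)" using rs1(2) by (simp add: span_minimal)
  have s: "s \<in> P" "s \<notin> span (set rs)" using D by (auto simp: independent_insert)
  then have s1: "s \<notin> span (set rs1)" "s \<notin> set rs1" using sub by (auto intro: span_base)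
  have ind: "independent ?B" using D1(3) s1 by (simp add: independent_insert)
  have BR: "set rs1 \<subseteq> span ?R" using rs1(2) span_mono[of "set rs" ?R] by auto
  have BR': "?B \<subseteq> span ?R" using BR by (auto intro: span_base)
  have spBR: "span ?B \<subseteq> span ?R" using BR' by (simp add: span_minimal)
  have zero: "representation ?R q s = 0" "representation ?B q s = 0" if q: "q \<in> span (set rs1)" for q
  proof -
    have "representation ?B q = representation (set rs1) q"
      by (rule real_vector.representation_extend[OF ind q]) auto
    then show "representation ?B q s = 0" using s1 real_vector.representation_ne_zero by metis
    have "representation ?R q = representation (set rs) q"
      by (rule real_vector.representation_extend[OF D(3)]) (use sub q in auto)
    moreover have "s \<notin> set rs" using D(1) by simp
    ultimately show "representation ?R q s = 0" using real_vector.representation_ne_zero by metis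
  qed
  \<comment> \<open>Heights refer to s # rs, where positive roots are already known to have
    nonnegative coordinates.\<close>
  define h where "h v = (\<Sum>d\<in>?R. representation ?R v d)" for v
  have h_diff: "h (p - k *\<^sub>R q) = h p - k * h q" if "p \<in> span ?R" "q \<in> span ?R" for p q k
    using that D(3) unfolding h_def
    by (simp add: real_vector.representation_diff real_vector.representation_scale span_scale
        sum_subtractf sum_distrib_left algebra_simps)
  have h_pos: "0 < h p" if p: "p \<in> P" "p \<in> span ?R" for p
  proof -
    have nn: "0 \<le> representation ?R p d" for d using simple_list_D(5)[OF rs p] .
    have "h p \<noteq> 0"
    proof
      assume "h p = 0"
      then have "\<forall>d\<in>?R. representation ?R p d = 0"
        unfolding h_def using nn by (subst (asm) sum_nonneg_eq_0_iff) auto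
      then have "(\<Sum>d\<in>?R. representation ?R p d *\<^sub>R d) = 0" by (intro sum.neutral) simp
      then have "p = 0" using real_vector.sum_representation_eq[OF D(3) p(2), of ?R] by simp
      then show False using P_nonzero p by blast
    qed
    moreover have "0 \<le> h p" unfolding h_def using nn by (rule sum_nonneg)
    ultimately show ?thesis by simp
  qed
  define bad where "bad = {p \<in> P. p \<in> span ?B \<and> (\<exists>d. representation ?B p d < 0)}"
  have "bad = {}"
  proof (rule ccontr)
    assume "bad \<noteq> {}"
    then obtain p where p: "p \<in> bad" and min: "\<And>q. q \<in> bad \<Longrightarrow> h p \<le> h q"
      using fin by (metis (no_types, lifting) arg_min_if_finite(1,2) bad_def finite_subset mem_Collect_eq not_le subsetI)
    from p have pP: "p \<in> P" and pB: "p \<in> span ?B" and pneg: "\<exists>d. representation ?B p d < 0"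
      by (auto simp: bad_def)
    have pR: "p \<in> span ?R" using pB spBR by blast
    obtain l where l: "p - l *\<^sub>R s \<in> span (set rs1)" using pB by (auto simp: span_breakdown_eq)
    define q where "q = p - l *\<^sub>R s"
    have q: "q \<in> span (set rs1)" and pq: "p = l *\<^sub>R s + q" using l by (simp_all add: q_def)
    have qB: "q \<in> span ?B" and qR: "q \<in> span ?R"
      using q span_mono[of "set rs1" ?B] spBR by auto
    have sB: "s \<in> span ?B" "s \<in> span ?R" by (simp_all add: span_base)
    have lB: "representation ?B p s = l"
      unfolding pq using ind sB qB zero(2)[OF q]
      by (simp add: real_vector.representation_add real_vector.representation_scale
          real_vector.representation_basis span_scale)
    have lR: "representation ?R p s = l"
      unfolding pq using D(3) sB qR zero(1)[OF q]
      by (simp add: real_vector.representation_add real_vector.representation_scale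
          real_vector.representation_basis span_scale)
    have "0 \<le> l" using simple_list_D(5)[OF rs pP pR, of s] lR by simp
    \<comment> \<open>Otherwise p would lie in the span of rs1, where no positive root has a
      negative coordinate.\<close>
    moreover have "l \<noteq> 0"
    proof
      assume "l = 0"
      then have "p \<in> span (set rs1)" using pq q by simp
      moreover from this have "representation ?B p = representation (set rs1) p"
        by (intro real_vector.representation_extend[OF ind]) auto
      ultimately show False using pneg simple_list_D(5)[OF rs1(1) pP] by (metis not_le)
    qed
    ultimately have lpos: "0 < l" by simp
    have "p \<noteq> s"
      using pneg ind by (auto simp: real_vector.representation_basis split: if_splits)
    \<comment> \<open>For d in rs1 the reflection leaves the coordinate l > 0 at s unchanged, which
      forces positivity.\<close>
    have rP: "refl_along d p \<in> P" if d: "d \<in> ?B" for d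
    proof (cases "d = s")
      case True
      then show ?thesis using simple_list_refl[OF rs _ pP pR \<open>p \<noteq> s\<close>] by simp
    next
      case False
      then have d1: "d \<in> set rs1" using d by simp
      then have dP: "d \<in> P" "d \<in> span ?R" "d \<in> span (set rs1)" using D1 BR by (auto intro: span_base)
      have eq: "refl_along d p = p - (2 * (p \<bullet> d)) *\<^sub>R d" using unit dP by (simp add: refl_along_unit)
      have "representation ?R (refl_along d p) s = l"
        unfolding eq using D(3) pR dP zero(1)[OF dP(3)] lR
        by (simp add: real_vector.representation_diff real_vector.representation_scale span_scale)
      moreover have "refl_along d p \<in> span ?R"
        unfolding eq using pR dP by (simp add: span_diff span_scale)
      ultimately show ?thesis
        using simple_list_pos_coord[OF rs all_roots_refl] lpos P_all_roots pP dP(1) by metis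
    qed
    \<comment> \<open>A positive inner product would make \<open>refl_along d p\<close> a lower
      positive root, hence not bad; adding back a positive multiple of d would then leave p without
      a negative coordinate.\<close>
    have le: "p \<bullet> d \<le> 0" if d: "d \<in> ?B" for d
    proof (rule ccontr)
      assume "\<not> p \<bullet> d \<le> 0"
      then have pos: "0 < p \<bullet> d" by simp
      have dP: "d \<in> P" "d \<in> span ?R" "d \<in> span ?B" using d D1 s BR' by (auto intro: span_base)
      have eq: "refl_along d p = p - (2 * (p \<bullet> d)) *\<^sub>R d" using unit dP by (simp add: refl_along_unit)
      have "0 < 2 * (p \<bullet> d) * h d" using pos h_pos[OF dP(1,2)] by simp
      then have "h (refl_along d p) < h p" unfolding eq h_diff[OF pR dP(2)] by simp
      then have "refl_along d p \<notin> bad" using min by force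
      moreover have "refl_along d p \<in> span ?B" unfolding eq using pB dP by (simp add: span_diff span_scale)
      ultimately have nn: "0 \<le> representation ?B (refl_along d p) e" for e
        using rP[OF d] by (auto simp: bad_def not_less)
      have "0 \<le> representation ?B p e" for e
      proof -
        have "representation ?B (refl_along d p) e = representation ?B p e - 2 * (p \<bullet> d) * representation ?B d e"
          unfolding eq using ind pB dP
          by (simp add: real_vector.representation_diff real_vector.representation_scale span_scale)
        moreover have "0 \<le> representation ?B d e" using ind d by (simp add: real_vector.representation_basis)
        ultimately show ?thesis using nn[of e] pos
          by (smt (verit) mult_nonneg_nonneg)
      qed
      then show False using pneg by (metis not_le)
    qed
    \<comment> \<open>Obtuseness between s and rs1 holds because every root in rs1 is a nonnegative
      combination of rs.\<close>
    have obt: "a \<bullet> b \<le> 0" if "a \<in> ?B" "b \<in> ?B" "a \<noteq> b" for a b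
    proof -
      have sb: "s \<bullet> b \<le> 0" if b: "b \<in> set rs1" for b
      proof -
        have bR: "b \<in> span (set rs)" "b \<in> span ?R" "b \<in> P" using b rs1 BR D1 by auto
        have i: "independent (set rs)" using D(3) independent_mono by fastforce
        have "representation ?R b = representation (set rs) b"
          using bR by (intro real_vector.representation_extend[OF D(3)]) auto
        then have nn: "0 \<le> representation (set rs) b d" for d
          using simple_list_D(5)[OF rs bR(3,2)] by metis
        have "s \<bullet> b = s \<bullet> (\<Sum>d\<in>set rs. representation (set rs) b d *\<^sub>R d)"
          using real_vector.sum_representation_eq[OF i bR(1), of "set rs"] by simp
        also have "\<dots> = (\<Sum>d\<in>set rs. representation (set rs) b d * (s \<bullet> d))"
          by (simp add: inner_sum_right)
        also have "\<dots> \<le> 0"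
        proof (intro sum_nonpos mult_nonneg_nonpos nn)
          fix d assume "d \<in> set rs"
          then show "s \<bullet> d \<le> 0" using D(1) by (intro simple_list_obtuse[OF rs]) auto
        qed
        finally show ?thesis .
      qed
      show ?thesis
        using that sb simple_list_obtuse[OF rs1(1)] by (auto simp: inner_commute)
    qed
    have "representation ?B p s \<le> 0"
      by (rule obtuse_dominated_nonpos[OF _ ind obt pB le]) auto
    then show False using lB lpos by simp
  qed
  then have "\<forall>p \<in> P \<inter> span ?B. \<forall>d. 0 \<le> representation ?B p d" by (auto simp: bad_def not_less)
  then show ?thesis using ind D1 s1 s by (auto simp: simple_list_def)
qed

section \<open>Coatoms below a Coxeter element\<close>

definition simple_coatom :: "'a list \<Rightarrow> 'a \<Rightarrow> bool" where
  "simple_coatom rs t \<longleftrightarrow> (\<exists>rs'. simple_list rs' \<and> length rs = Suc (length rs') \<and> set rs' \<subseteq> span (set rs) \<and>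
     refl_prod rs' = refl_prod rs \<circ> refl_along t)"

text \<open>Multiplying by s on the right conjugates the tail: the result is the product of the list
  rs reflected in s, and this list is simple since s is outside the span of rs.\<close>

lemma simple_coatom_self:
  assumes "simple_list (s # rs)"
  shows "simple_coatom (s # rs) s"
proof -
  note D = simple_list_D[OF assms]
  have "simple_list rs" by (rule simple_list_sub[OF assms]) (use D in auto)
  moreover have sn: "s \<notin> span (set rs)" using D by (auto simp: independent_insert)
  ultimately have "simple_list (map (refl_along s) rs)"
    by (intro simple_list_map_refl[OF assms]) (auto intro: span_base)
  moreover have "refl_along s r \<in> span (set (s # rs))" if "r \<in> set rs" for r
    using that refl_prod_in_span[of "[s]" "set (s # rs)" r] by (simp add: span_base)
  moreover have "refl_prod (map (refl_along s) rs) = refl_prod (s # rs) \<circ> refl_along s"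
    using refl_prod_map_conj[OF refl_along_orthogonal, of s rs]
    by (metis comp_assoc refl_along_invol comp_id refl_prod_simps(2))
  ultimately show ?thesis unfolding simple_coatom_def by (intro exI[of _ "map (refl_along s) rs"]) auto
qed

text \<open>Let f be the vector fixed by \<open>refl_prod (s # rs)\<close> composed with the
  reflection in t. If f is orthogonal to s, then t lies in the span of rs, and s can be put in front
  of a shorter word for rs. Otherwise the shorter word for the rotated list fixes
  \<open>refl_along s f\<close>, so its span misses s, and conjugation by s keeps it simple.\<close>

lemma simple_coatom_rotate:
  assumes IH: "\<And>t. t \<in> P \<Longrightarrow> t \<in> span (set rs) \<Longrightarrow> simple_coatom rs t"
    and simple_list: "simple_list (s # rs)" and t: "t \<in> P" "t \<in> span (set (s # rs))"
    and rot: "simple_coatom (rs @ [s]) (refl_along s t)"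
  shows "simple_coatom (s # rs) t"
proof -
  let ?R = "set (s # rs)"
  note D = simple_list_D[OF simple_list]
  have rs: "simple_list rs" by (rule simple_list_sub[OF simple_list]) (use D in auto)
  obtain f where f: "f \<in> span ?R" "f - refl_prod (rev (s # rs)) f = t" "2 * (f \<bullet> t) = 1"
    "refl_prod (s # rs) (refl_along t f) = f"
    using refl_prod_solve_unit[OF D(1,3) t(2) unit[OF t(1)]] .
  show ?thesis
  proof (cases "f \<bullet> s = 0")
    case True
    then have fs: "refl_along s f = f" by (simp add: refl_along_def)
    have "refl_prod rs (refl_along t f) = refl_along s (refl_along s (refl_prod rs (refl_along t f)))" by simp
    also have "\<dots> = f" using f(4) fs by simp
    finally have "refl_along t f = refl_prod (rev rs) f" by (metis refl_prod_rev(1))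
    then have "t = - (refl_prod (rev rs) f - f)" using f(3) unit[OF t(1)] by (simp add: refl_along_unit algebra_simps)
    then have "t \<in> span (set rs)" using refl_prod_diff_span[of "rev rs" f] by (metis set_rev span_neg)
    then obtain rs' where rs': "simple_list rs'" "length rs = Suc (length rs')" "set rs' \<subseteq> span (set rs)"
      "refl_prod rs' = refl_prod rs \<circ> refl_along t"
      using IH t(1) unfolding simple_coatom_def by blast
    have "simple_list (s # rs')" by (rule simple_list_Cons[OF simple_list rs'(1,3)])
    moreover have "set (s # rs') \<subseteq> span ?R"
      using rs'(3) span_mono[of "set rs" ?R] by (auto intro: span_base)
    moreover have "refl_prod (s # rs') = refl_prod (s # rs) \<circ> refl_along t" using rs'(4) by (simp add: comp_assoc)
    ultimately show ?thesis unfolding simple_coatom_def using rs'(2) by (intro exI[of _ "s # rs'"]) simp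
  next
    case False
    obtain rs' where rs': "simple_list rs'" "length (rs @ [s]) = Suc (length rs')"
      "set rs' \<subseteq> span (set (rs @ [s]))" "refl_prod rs' = refl_prod (rs @ [s]) \<circ> refl_along (refl_along s t)"
      using rot unfolding simple_coatom_def by blast
    have ss: "set (rs @ [s]) = ?R" by auto
    let ?g = "refl_along s"
    have conj: "refl_along (?g t) \<circ> ?g = ?g \<circ> refl_along t"
      by (rule refl_along_conj[OF refl_along_orthogonal])
    have "refl_prod rs' \<circ> ?g = refl_prod rs \<circ> ?g \<circ> (?g \<circ> refl_along t)"
      using rs'(4) conj by (simp add: comp_assoc)
    also have "\<dots> = refl_prod rs \<circ> refl_along t" by (simp add: fun_eq_iff)
    finally have eq: "refl_prod rs' \<circ> ?g = refl_prod rs \<circ> refl_along t" .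
    have eq2: "refl_prod (map ?g rs') = refl_prod (s # rs) \<circ> refl_along t"
    proof
      fix v
      have "refl_prod (map ?g rs') v = (refl_prod (map ?g rs') \<circ> ?g) (?g v)" by simp
      also have "\<dots> = ?g (refl_prod rs' (?g v))" using refl_prod_map_conj[OF refl_along_orthogonal, of s rs'] by simp
      also have "\<dots> = (refl_prod (s # rs) \<circ> refl_along t) v" using eq by (simp add: fun_eq_iff)
      finally show "refl_prod (map ?g rs') v = (refl_prod (s # rs) \<circ> refl_along t) v" .
    qed
    have "refl_prod rs' (?g f) = ?g f"
      using eq f(4) by (metis comp_apply refl_along_refl_along refl_prod_simps(2))
    then have orth: "?g f \<bullet> q = 0" if "q \<in> set rs'" for q
      using refl_prod_fixed_orth[OF simple_list_D(1,3)[OF rs'(1)]] that by blast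
    have "s \<notin> span (set rs')"
    proof
      assume "s \<in> span (set rs')"
      then have "?g f \<bullet> s = 0" using orth orthogonal_to_span[of s "set rs'" "?g f"]
        by (auto simp: orthogonal_def)
      then show False using False refl_along_inner[of s f s] by simp
    qed
    then have "simple_list (map ?g rs')"
      using rs'(1,3) unfolding ss by (intro simple_list_map_refl[OF simple_list]) auto
    moreover have "?g r \<in> span ?R" if "r \<in> span ?R" for r
      using that refl_prod_in_span[of "[s]" ?R r] by (simp add: span_base)
    then have "set (map ?g rs') \<subseteq> span ?R" using rs'(3) unfolding ss by auto
    ultimately show ?thesis
      unfolding simple_coatom_def using rs'(2) eq2 by (intro exI[of _ "map ?g rs'"]) auto
  qed
qed

text \<open>Rotating the word \<open>rs\<close> moves \<open>t\<close> through its orbit under the Coxeter element. The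
  orbit sum is a fixed vector, hence zero, so the orbit cannot consist of positive roots; when
  \<open>t\<close> turns negative it equals the first letter, and \<open>simple_coatom_self\<close> applies.\<close>

lemma simple_coatom_P: "simple_list rs \<Longrightarrow> t \<in> P \<Longrightarrow> t \<in> span (set rs) \<Longrightarrow> simple_coatom rs t"
proof (induction "length rs" arbitrary: rs t rule: less_induct)
  case less
  note D = simple_list_D[OF less.prems(1)]
  \<comment> \<open>A positive root without the coatom property is not the first letter, so it stays
    positive when that letter moves to the end; tails are shorter and fall under the induction
    hypothesis. With all of rs as us, \<open>refl_prod (rev rs)\<close> maps failing roots of rs to
    failing roots of rs.\<close>
  have rotated: "refl_prod (rev us) t \<in> P \<and> \<not> simple_coatom (vs @ us) (refl_prod (rev us) t)"
    if "simple_list (us @ vs)" "length (us @ vs) = length rs" "t \<in> P" "t \<in> span (set (us @ vs))"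
      "\<not> simple_coatom (us @ vs) t" for us vs t
    using that
  proof (induction us arbitrary: vs t)
    case (Cons s us)
    note simple_list = Cons.prems(1)[unfolded append_Cons]
    have SCuv: "simple_list (us @ vs)" by (rule simple_list_sub[OF simple_list]) (use simple_list_D(1)[OF simple_list] in auto)
    have "t \<noteq> s" using Cons.prems simple_coatom_self[OF simple_list] by auto
    then have 1: "refl_along s t \<in> P" using Cons.prems by (intro simple_list_refl[OF simple_list]) auto
    have "length (us @ vs) < length rs" using Cons.prems(2) by simp
    then have "simple_coatom (us @ vs) t" if "t \<in> P" "t \<in> span (set (us @ vs))" for t
      using less.hyps SCuv that by blast
    then have 2: "\<not> simple_coatom ((us @ vs) @ [s]) (refl_along s t)"
      using simple_coatom_rotate[OF _ simple_list Cons.prems(3)] Cons.prems(4,5) by auto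
    have 3: "simple_list (us @ vs @ [s])" by (rule simple_list_sub[OF simple_list]) (use simple_list_D(1)[OF simple_list] in auto)
    have ss: "set (us @ vs @ [s]) = set (s # us @ vs)" by auto
    have "refl_along s t \<in> span (set (us @ vs @ [s]))"
      unfolding ss using Cons.prems(4) refl_prod_in_span[of "[s]" "set (s # us @ vs)" t] by (simp add: span_base)
    then show ?case using Cons.IH[of "vs @ [s]" "refl_along s t"] 1 2 3 Cons.prems(2) by simp
  qed simp
  let ?g = "refl_prod (rev rs)"
  define X where "X = {x \<in> P. x \<in> span (set rs) \<and> \<not> simple_coatom rs x}"
  have finX: "finite X" unfolding X_def using fin by simp
  have "?g x \<in> X" if "x \<in> X" for x
    using that rotated[of rs "[]" x] less.prems(1) refl_prod_rev_in_span[of rs "set rs" x]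
    by (auto simp: X_def span_base subset_iff)
  moreover have "inj_on ?g X" by (metis inj_onI refl_prod_rev(2))
  ultimately have gX: "?g ` X = X" using finX by (simp add: endo_inj_surj image_subsetI)
  have "?g (\<Sum>X) = (\<Sum>x\<in>X. ?g x)" using linear_sum[OF refl_prod_linear, of "rev rs" "\<lambda>x. x" X] .
  also have "\<dots> = \<Sum>X" using gX \<open>inj_on ?g X\<close> by (metis (no_types, lifting) sum.reindex_cong)
  finally have "refl_prod rs (\<Sum>X) = \<Sum>X" by (metis refl_prod_rev(2))
  moreover have "\<Sum>X \<in> span (set rs)" by (rule span_sum) (simp add: X_def)
  ultimately have X0: "\<Sum>X = 0" using refl_prod_fixed_zero[OF D(1,3)] by blast
  show "simple_coatom rs t"
  proof (rule ccontr)
    assume "\<not> simple_coatom rs t"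
    then have tX: "t \<in> X" using less.prems by (simp add: X_def)
    have "representation (set rs) t d = 0" for d
    proof -
      have "(\<Sum>x\<in>X. representation (set rs) x d) = representation (set rs) (\<Sum>X) d"
        using D(3) by (subst real_vector.representation_sum) (auto simp: X_def)
      also have "\<dots> = 0" using X0 D(3) by (simp add: real_vector.representation_zero)
      finally show ?thesis
        using tX finX simple_list_D(5)[OF less.prems(1)]
        by (subst (asm) sum_nonneg_eq_0_iff) (auto simp: X_def)
    qed
    then have "t = 0" using real_vector.sum_representation_eq[OF D(3) less.prems(3), of "set rs"] by simp
    then show False using P_nonzero less.prems by blast
  qed
qed

lemma simple_coatom_all_roots: "simple_list rs \<Longrightarrow> t \<in> all_roots \<Longrightarrow> t \<in> span (set rs) \<Longrightarrow> simple_coatom rs t"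
  using simple_coatom_P[of rs t] simple_coatom_P[of rs "- t"] by (auto simp: all_roots_def simple_coatom_def span_neg)

text \<open>A factorisation of minimal length has its letters in the span of rs, so its last letter
  gives a coatom. The letters of vs are peeled off from the right in this way.\<close>

lemma simple_list_prefix:
  assumes "simple_list rs" "set us \<subseteq> all_roots" "set vs \<subseteq> all_roots" "refl_prod (us @ vs) = refl_prod rs" "length (us @ vs) = length rs"
  obtains rs' where "simple_list rs'" "refl_prod rs' = refl_prod us" "length rs' = length us" "set rs' \<subseteq> span (set rs)"
  using assms
proof (induction vs arbitrary: rs thesis rule: rev_induct)
  case Nil
  then show ?case by (auto intro: span_base)
next
  case (snoc q vs)
  note D = simple_list_D[OF snoc.prems(2)]
  have "q \<in> span (set rs)"
    using refl_prod_same_length(3)[OF D(1,3) snoc.prems(5,6)] span_base[of q "set (us @ vs @ [q])"] by auto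
  then obtain rs' where rs': "simple_list rs'" "length rs = Suc (length rs')" "set rs' \<subseteq> span (set rs)"
    "refl_prod rs' = refl_prod rs \<circ> refl_along q"
    using simple_coatom_all_roots[OF snoc.prems(2), of q] snoc.prems(4) unfolding simple_coatom_def by auto
  have "refl_prod rs' = refl_prod (us @ vs)"
    unfolding rs'(4) snoc.prems(5)[symmetric] by (simp add: fun_eq_iff)
  then obtain rs'' where "simple_list rs''" "refl_prod rs'' = refl_prod us" "length rs'' = length us" "set rs'' \<subseteq> span (set rs')"
    using snoc.IH[OF _ rs'(1)] snoc.prems rs'(2) by auto
  then show ?case using snoc.prems(1) rs'(3) span_minimal[OF rs'(3) subspace_span] by blast
qed

text \<open>Coatoms are formed by multiplying on the right, so a first letter q is carried to the
  right end, where it becomes the reflection in t, the preimage of q under the remaining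
  word.\<close>

lemma simple_list_suffix:
  assumes "simple_list rs" "set us \<subseteq> all_roots" "set vs \<subseteq> all_roots" "refl_prod (us @ vs) = refl_prod rs" "length (us @ vs) = length rs"
  obtains rs' where "simple_list rs'" "refl_prod rs' = refl_prod vs" "length rs' = length vs" "set rs' \<subseteq> span (set rs)"
  using assms
proof (induction us arbitrary: rs thesis)
  case Nil
  then show ?case by (auto intro: span_base)
next
  case (Cons q us)
  note D = simple_list_D[OF Cons.prems(2)]
  define g where "g = refl_prod (us @ vs)"
  define t where "t = refl_prod (rev (us @ vs)) q"
  have q: "q \<in> all_roots" using Cons.prems by simp
  have t: "t \<in> all_roots" unfolding t_def using Cons.prems by (intro refl_prod_all_roots) auto
  have gt: "g t = q" by (simp only: g_def t_def refl_prod_rev)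
  have eq: "refl_prod rs = g \<circ> refl_along t"
    using refl_prod_conj[of "us @ vs" t] gt Cons.prems(5) unfolding g_def append_Cons by (metis refl_prod_simps(2))
  have "q \<in> span (set rs)"
    using refl_prod_same_length(3)[OF D(1,3) Cons.prems(5,6)] span_base[of q "set ((q # us) @ vs)"] by auto
  then have "refl_prod (rev rs) q \<in> span (set rs)" by (intro refl_prod_rev_in_span) (auto intro: span_base)
  moreover have "refl_prod rs (- t) = q" using eq gt by (simp add: linear_neg[OF refl_along_linear])
  then have "refl_prod (rev rs) q = - t" by (metis refl_prod_rev(1))
  ultimately have "t \<in> span (set rs)" using span_neg by fastforce
  then obtain rs' where rs': "simple_list rs'" "length rs = Suc (length rs')" "set rs' \<subseteq> span (set rs)"
    "refl_prod rs' = refl_prod rs \<circ> refl_along t"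
    using simple_coatom_all_roots[OF Cons.prems(2) t] unfolding simple_coatom_def by auto
  have "refl_prod (us @ vs) = refl_prod rs'" unfolding rs'(4) eq by (simp add: fun_eq_iff g_def)
  then obtain rs'' where "simple_list rs''" "refl_prod rs'' = refl_prod vs" "length rs'' = length vs" "set rs'' \<subseteq> span (set rs')"
    using Cons.IH[OF _ rs'(1)] Cons.prems rs'(2) by auto
  then show ?case using Cons.prems(1) rs'(3) span_minimal[OF rs'(3) subspace_span] by blast
qed

end

section \<open>Absolute order in a finite reflection group\<close>

text \<open>A reflection comes from at most two unit vectors.\<close>

lemma finite_reflections_imp_finite_roots:
  assumes "finite W"
  shows "finite (roots W)"
proof -
  have "finite {a::'a. norm a = 1 \<and> refl_along a = w}" for w
  proof (cases "\<exists>b::'a. norm b = 1 \<and> refl_along b = w")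
    case True
    then obtain b where "norm b = 1" "refl_along b = w" by blast
    then have "{a. norm a = 1 \<and> refl_along a = w} \<subseteq> {b, - b}"
      using refl_along_eq_iff[of _ b] by fastforce
    then show ?thesis by (rule finite_subset) simp
  next
    case False
    then have "{a::'a. norm a = 1 \<and> refl_along a = w} = {}" by blast
    then show ?thesis by (simp only: finite.emptyI)
  qed
  then have "finite (\<Union>w\<in>W. {a::'a. norm a = 1 \<and> refl_along a = w})" using assms by (intro finite_UN_I)
  then show ?thesis by (rule rev_finite_subset) (auto simp: roots_def)
qed

lemma reflections_eq_roots: "reflections W = refl_along ` roots W"
proof
  show "reflections W \<subseteq> refl_along ` roots W"
  proof
    fix s assume "s \<in> reflections W"
    then obtain a where a: "s = refl_along a" "a \<noteq> 0" "refl_along a \<in> W"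
      unfolding reflections_def by blast
    have "a \<bullet> a = norm a * norm a" by (simp add: dot_square_norm power2_eq_square)
    then have "refl_along (a /\<^sub>R norm a) = refl_along a"
      using a(2) unfolding refl_along_def by (auto simp: fun_eq_iff)
    then show "s \<in> refl_along ` roots W"
      using a by (intro image_eqI[of _ _ "a /\<^sub>R norm a"]) (auto simp: roots_def)
  qed
qed (auto simp: reflections_def roots_def)

locale coxeter_group =
  fixes W :: "('a::euclidean_space \<Rightarrow> 'a) set" and \<Delta> :: "'a set"
  assumes W: "finite_reflection_group W" and \<Delta>: "simple_roots W \<Delta>"
begin

definition P :: "'a set" where
  "P = {a \<in> roots W. \<exists>k. (\<forall>d\<in>\<Delta>. 0 \<le> k d) \<and> a = (\<Sum>d\<in>\<Delta>. k d *\<^sub>R d)}"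

lemma roots_refl: "a \<in> roots W \<Longrightarrow> b \<in> roots W \<Longrightarrow> refl_along a b \<in> roots W"
proof -
  assume ab: "a \<in> roots W" "b \<in> roots W"
  have "refl_along (refl_along a b) \<circ> refl_along a = refl_along a \<circ> refl_along b"
    by (rule refl_along_conj[OF refl_along_orthogonal])
  then have "refl_along (refl_along a b) = refl_along a \<circ> refl_along b \<circ> refl_along a"
    by (metis comp_assoc comp_id refl_along_invol)
  moreover have "norm (refl_along a b) = norm b"
    using refl_along_orthogonal by (rule orthogonal_transformation_norm)
  ultimately show ?thesis using ab group_closed(2)[OF W] by (auto simp: roots_def)
qed

lemma \<Delta>_props: "\<Delta> \<subseteq> roots W" "independent \<Delta>" "finite \<Delta>"
  using \<Delta> by (auto simp: simple_roots_def intro: independent_imp_finite)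

lemma roots_cases: "a \<in> roots W \<longleftrightarrow> a \<in> P \<or> - a \<in> P"
proof
  assume a: "a \<in> roots W"
  then have "- a \<in> roots W" by (simp add: roots_def)
  moreover obtain k where "\<forall>d\<in>\<Delta>. 0 \<le> k d"
    "a = (\<Sum>d\<in>\<Delta>. k d *\<^sub>R d) \<or> a = - (\<Sum>d\<in>\<Delta>. k d *\<^sub>R d)"
    using a \<Delta> unfolding simple_roots_def by blast
  ultimately show "a \<in> P \<or> - a \<in> P" using a unfolding P_def by fastforce
qed (auto simp: P_def roots_def)

sublocale positive_system P
proof
  have fr: "finite (roots W)"
    using W by (intro finite_reflections_imp_finite_roots) (simp add: finite_reflection_group_def)
  show "finite P" by (rule finite_subset[OF _ fr]) (auto simp: P_def)
  show "norm p = 1" if "p \<in> P" for p using that by (simp add: P_def roots_def)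
  show "- p \<notin> P" if p: "p \<in> P" for p
  proof
    assume "- p \<in> P"
    then obtain k l where k: "\<forall>d\<in>\<Delta>. 0 \<le> k d" "p = (\<Sum>d\<in>\<Delta>. k d *\<^sub>R d)"
      and l: "\<forall>d\<in>\<Delta>. 0 \<le> l d" "- p = (\<Sum>d\<in>\<Delta>. l d *\<^sub>R d)"
      using p unfolding P_def by blast
    have "(\<Sum>d\<in>\<Delta>. (k d + l d) *\<^sub>R d) = p + - p"
      unfolding k(2)[symmetric] l(2)
      by (simp only: k(2) scaleR_left_distrib sum.distrib)
    then have 0: "(\<Sum>d\<in>\<Delta>. (k d + l d) *\<^sub>R d) = 0" by simp
    have "k d + l d = 0" if "d \<in> \<Delta>" for d
      using real_vector.independentD[OF \<Delta>_props(2,3) subset_refl 0 that] .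
    then have "k d = 0" if "d \<in> \<Delta>" for d using k(1) l(1) that by (metis add_nonneg_eq_0_iff)
    then have "p = 0" using k(2) by simp
    then show False using p by (simp add: P_def roots_def)
  qed
  show "refl_along p q \<in> P \<or> - refl_along p q \<in> P" if "p \<in> P" "q \<in> P" for p q
    using roots_refl[of p q] roots_cases that by blast
qed

lemma all_roots_roots: "all_roots = roots W"
  by (auto simp: all_roots_def roots_cases)

lemma \<Delta>_P: "\<Delta> \<subseteq> P"
proof
  fix d assume d: "d \<in> \<Delta>"
  have "(\<Sum>e\<in>\<Delta>. (if e = d then 1 else 0) *\<^sub>R e) = (\<Sum>e\<in>\<Delta>. if e = d then e else 0)"
    by (intro sum.cong) auto
  also have "\<dots> = d" using d \<Delta>_props(3) by simp
  finally show "d \<in> P"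
    using d \<Delta>_props(1) unfolding P_def by (auto intro!: exI[of _ "\<lambda>e. if e = d then 1 else 0"])
qed

lemma all_roots_span: "a \<in> all_roots \<Longrightarrow> a \<in> span \<Delta>"
proof -
  have "a \<in> span \<Delta>" if a: "a \<in> P" for a
  proof -
    obtain k where "a = (\<Sum>d\<in>\<Delta>. k d *\<^sub>R d)" using a by (auto simp: P_def)
    then show ?thesis by (simp add: span_sum span_scale span_base)
  qed
  then show "a \<in> all_roots \<Longrightarrow> a \<in> span \<Delta>" using span_neg[of "- a" \<Delta>] by (auto simp: all_roots_def)
qed

lemma simple_list_\<Delta>:
  assumes "distinct ds" "set ds = \<Delta>"
  shows "simple_list ds"
  unfolding simple_list_def assms(2)
proof (intro conjI ballI allI)
  fix p d assume "p \<in> P \<inter> span \<Delta>"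
  then obtain k where "\<forall>d\<in>\<Delta>. 0 \<le> k d" "p = (\<Sum>d\<in>\<Delta>. k d *\<^sub>R d)" unfolding P_def by blast
  then show "0 \<le> representation \<Delta> p d"
    using representation_nonneg[OF \<Delta>_props(2,3), of "\<lambda>d. d" k d] by simp
qed (use assms \<Delta>_props \<Delta>_P in auto)

section \<open>Absolute length and absolute order\<close>

lemma W_refl_prod: "w \<in> W \<longleftrightarrow> (\<exists>qs. set qs \<subseteq> all_roots \<and> w = refl_prod qs)"
proof -
  have "(\<exists>ws. set ws \<subseteq> refl_along ` all_roots \<and> w = word_prod ws) \<longleftrightarrow> (\<exists>qs. set qs \<subseteq> all_roots \<and> w = refl_prod qs)"
  proof
    assume "\<exists>ws. set ws \<subseteq> refl_along ` all_roots \<and> w = word_prod ws"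
    then obtain ws where ws: "ws \<in> lists (refl_along ` all_roots)" "w = word_prod ws" by auto
    then obtain qs where "ws = map refl_along qs" "set qs \<subseteq> all_roots" by (auto simp: lists_image)
    then show "\<exists>qs. set qs \<subseteq> all_roots \<and> w = refl_prod qs" using ws(2) by (auto simp: refl_prod_def)
  next
    assume "\<exists>qs. set qs \<subseteq> all_roots \<and> w = refl_prod qs"
    then obtain qs where "set qs \<subseteq> all_roots" "w = refl_prod qs" by blast
    then show "\<exists>ws. set ws \<subseteq> refl_along ` all_roots \<and> w = word_prod ws"
      by (intro exI[of _ "map refl_along qs"]) (auto simp: refl_prod_def)
  qed
  then show ?thesis
    by (subst finite_reflection_group_words[OF W])
       (auto simp only: reflections_eq_roots all_roots_roots mem_Collect_eq conj_commute)
qed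

lemma W_I: "set qs \<subseteq> all_roots \<Longrightarrow> refl_prod qs \<in> W"
  using W_refl_prod by blast

lemma rk_list:
  assumes "w \<in> W"
  obtains qs where "set qs \<subseteq> all_roots" "refl_prod qs = w" "length qs = rk W w"
proof -
  obtain ws where ws: "set ws \<subseteq> reflections W" "word_prod ws = w" "length ws = rk W w"
    using rk_word[OF W assms] .
  then have "ws \<in> lists (refl_along ` all_roots)" using reflections_eq_roots all_roots_roots by auto
  then obtain qs where "ws = map refl_along qs" "set qs \<subseteq> all_roots" by (auto simp: lists_image)
  then show thesis using that ws by (auto simp: refl_prod_def)
qed

lemma rk_refl_prod_le: "set qs \<subseteq> all_roots \<Longrightarrow> rk W (refl_prod qs) \<le> length qs"
  using rk_le[of "map refl_along qs" W] by (auto simp: refl_prod_def reflections_eq_roots all_roots_roots)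

lemma rk_refl_prod:
  assumes "distinct qs" "independent (set qs)" "set qs \<subseteq> all_roots"
  shows "rk W (refl_prod qs) = length qs"
proof (rule antisym[OF rk_refl_prod_le[OF assms(3)]])
  obtain us where "refl_prod us = refl_prod qs" "length us = rk W (refl_prod qs)" using rk_list[OF W_I[OF assms(3)]] by metis
  then show "length qs \<le> rk W (refl_prod qs)" using refl_prod_length_le[OF assms(1,2), of us] by simp
qed

lemma rk_simple_list: "simple_list rs \<Longrightarrow> rk W (refl_prod rs) = length rs"
  using rk_refl_prod simple_list_D by blast

lemma W_comp_inv: "f \<in> W \<Longrightarrow> inv f \<circ> f = id" "f \<in> W \<Longrightarrow> f \<circ> inv f = id"
  using group_closed(3)[OF W] by (auto simp: bij_def surj_iff)

lemma W_comp_inv_left: "f \<in> W \<Longrightarrow> inv f \<circ> (f \<circ> g) = g" "f \<in> W \<Longrightarrow> f \<circ> (inv f \<circ> g) = g"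
  by (simp_all add: comp_assoc[symmetric] W_comp_inv)

lemma rk_refl: "t \<in> all_roots \<Longrightarrow> rk W (refl_along t) = 1"
  using rk_refl_prod[of "[t]"] all_roots_unit[of t] by (cases "t = 0") (auto simp: dependent_single)

lemma refl_W: "t \<in> all_roots \<Longrightarrow> refl_along t \<in> W"
  using W_I[of "[t]"] by simp

lemma abs_le_refl: "w \<in> W \<Longrightarrow> abs_le W w w"
  using rk_eq_0[OF W group_closed(1)[OF W]] by (simp add: abs_le_def W_comp_inv)

lemma abs_le_trans:
  assumes "abs_le W u v" "abs_le W v w"
  shows "abs_le W u w"
proof -
  have m: "u \<in> W" "v \<in> W" "w \<in> W" using assms by (auto simp: abs_le_def)
  note grp = group_closed[OF W]
  have "(inv u \<circ> v) \<circ> (inv v \<circ> w) = inv u \<circ> w" using m by (simp add: comp_assoc W_comp_inv_left)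
  then have 1: "rk W (inv u \<circ> w) \<le> rk W (inv u \<circ> v) + rk W (inv v \<circ> w)"
    using rk_comp_le[OF W, of "inv u \<circ> v" "inv v \<circ> w"] grp m by simp
  have 2: "rk W w \<le> rk W u + rk W (inv u \<circ> w)"
    using rk_comp_le[OF W, of u "inv u \<circ> w"] grp m by (simp add: W_comp_inv_left)
  show ?thesis using 1 2 assms m by (simp add: abs_le_def)
qed

text \<open>Shortest words of v and of its complement concatenate to a shortest word of the Coxeter
  element. So both are Coxeter elements of parabolic subsystems, v as a prefix and the complement as
  a suffix.\<close>

lemma abs_le_lists:
  assumes "abs_le W v (refl_prod rs)" "simple_list rs"
  obtains us ks where "simple_list us" "simple_list ks" "refl_prod us = v" "refl_prod ks = inv v \<circ> refl_prod rs"
    "set us \<subseteq> span (set rs)" "set ks \<subseteq> span (set rs)" "length us + length ks = length rs"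
proof -
  have v: "v \<in> W" and r: "refl_prod rs \<in> W" and rk: "rk W (refl_prod rs) = rk W v + rk W (inv v \<circ> refl_prod rs)"
    using assms(1) by (auto simp: abs_le_def)
  have k: "inv v \<circ> refl_prod rs \<in> W" using v r group_closed[OF W] by simp
  obtain us where us: "set us \<subseteq> all_roots" "refl_prod us = v" "length us = rk W v" using rk_list[OF v] .
  obtain ks where ks: "set ks \<subseteq> all_roots" "refl_prod ks = inv v \<circ> refl_prod rs" "length ks = rk W (inv v \<circ> refl_prod rs)"
    using rk_list[OF k] .
  have eq: "refl_prod (us @ ks) = refl_prod rs" using us ks v by (simp add: W_comp_inv_left)
  have len: "length (us @ ks) = length rs" using us ks rk rk_simple_list[OF assms(2)] by simp
  obtain us' where "simple_list us'" "refl_prod us' = refl_prod us" "length us' = length us" "set us' \<subseteq> span (set rs)"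
    using simple_list_prefix[OF assms(2) us(1) ks(1) eq len] .
  moreover obtain ks' where "simple_list ks'" "refl_prod ks' = refl_prod ks" "length ks' = length ks" "set ks' \<subseteq> span (set rs)"
    using simple_list_suffix[OF assms(2) us(1) ks(1) eq len] .
  ultimately show thesis using that us ks len by auto
qed

lemma abs_le_simple_list: "abs_le W v (refl_prod rs) \<Longrightarrow> simple_list rs \<Longrightarrow> \<exists>us. simple_list us \<and> refl_prod us = v"
  using abs_le_lists by metis

lemma abs_leI:
  assumes "set us \<subseteq> all_roots" "set ks \<subseteq> all_roots" "refl_prod us = v" "refl_prod ks = inv v \<circ> w" "length us + length ks \<le> rk W w"
    "w \<in> W"
  shows "abs_le W v w"
proof -
  have v: "v \<in> W" using assms W_I by blast
  have 1: "rk W v \<le> length us" "rk W (inv v \<circ> w) \<le> length ks" using rk_refl_prod_le assms by metis+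
  have "rk W w \<le> rk W v + rk W (inv v \<circ> w)"
    using rk_comp_le[OF W, of v "inv v \<circ> w"] v assms(6) group_closed[OF W] by (simp add: W_comp_inv_left)
  then show ?thesis using 1 v assms by (simp add: abs_le_def)
qed

section \<open>Coxeter length\<close>

abbreviation (input) len :: "('a \<Rightarrow> 'a) \<Rightarrow> nat" where "len \<equiv> word_length (refl_along ` \<Delta>)"

lemma len_le: "set qs \<subseteq> \<Delta> \<Longrightarrow> len (refl_prod qs) \<le> length qs"
  unfolding word_length_def
  by (rule Least_le, rule exI[of _ "map refl_along qs"]) (auto simp: refl_prod_def)

text \<open>Take a counterexample p with least coordinate sum. As p . p > 0 and the coordinates are
  nonnegative, p . d > 0 for some simple d. Then \<open>refl_along d p\<close> is positive with a
  smaller coordinate sum, and conjugating its word by d gives a word for p.\<close>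

lemma refl_simple_word:
  assumes "p \<in> P"
  shows "\<exists>qs. set qs \<subseteq> \<Delta> \<and> refl_along p = refl_prod qs"
proof (rule ccontr)
  assume neg_thesis: "\<not> ?thesis"
  define h where "h v = (\<Sum>d\<in>\<Delta>. representation \<Delta> v d)" for v
  define bad where "bad = {p \<in> P. \<not> (\<exists>qs. set qs \<subseteq> \<Delta> \<and> refl_along p = refl_prod qs)}"
  obtain ds where ds: "distinct ds" "set ds = \<Delta>" using finite_distinct_list[OF \<Delta>_props(3)] by blast
  note simple_list = simple_list_\<Delta>[OF ds]
  note ind = \<Delta>_props(2)
  have "bad \<noteq> {}" "finite bad" using neg_thesis assms fin by (auto simp: bad_def)
  then obtain p where p: "p \<in> bad" and min: "\<And>q. q \<in> bad \<Longrightarrow> \<not> h q < h p"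
    using arg_min_if_finite[of bad h] by blast
  have pP: "p \<in> P" using p by (simp add: bad_def)
  have psp: "p \<in> span \<Delta>" using pP all_roots_span P_all_roots by blast
  have "\<exists>d\<in>\<Delta>. 0 < p \<bullet> d"
  proof (rule ccontr)
    assume "\<not> ?thesis"
    then have "p \<bullet> d \<le> 0" if "d \<in> \<Delta>" for d using that by (auto simp: not_less)
    then have "(\<Sum>d\<in>\<Delta>. representation \<Delta> p d * (p \<bullet> d)) \<le> 0"
      using simple_list_D(5)[OF simple_list pP] psp unfolding ds by (intro sum_nonpos mult_nonneg_nonpos) auto
    also have "(\<Sum>d\<in>\<Delta>. representation \<Delta> p d * (p \<bullet> d)) = p \<bullet> (\<Sum>d\<in>\<Delta>. representation \<Delta> p d *\<^sub>R d)"
      by (simp add: inner_sum_right)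
    also have "\<dots> = p \<bullet> p"
      using real_vector.sum_representation_eq[OF ind psp \<Delta>_props(3)] by simp
    finally show False using P_nonzero[OF pP] by (metis inner_gt_zero_iff not_le)
  qed
  then obtain d where d: "d \<in> \<Delta>" "0 < p \<bullet> d" by blast
  have "p \<notin> \<Delta>"
  proof
    assume "p \<in> \<Delta>"
    then have "set [p] \<subseteq> \<Delta> \<and> refl_along p = refl_prod [p]" by simp
    then show False using p unfolding bad_def by blast
  qed
  then have rP: "refl_along d p \<in> P" using simple_list_refl[OF simple_list, of d p] d pP psp ds by auto
  have dP: "d \<in> P" "d \<in> span \<Delta>" using d \<Delta>_P by (auto intro: span_base)
  have "h (refl_along d p) = h p - 2 * (p \<bullet> d) * h d"
    unfolding h_def refl_along_unit[OF unit[OF dP(1)]] using ind psp dP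
    by (simp add: real_vector.representation_diff real_vector.representation_scale span_scale
        sum_subtractf sum_distrib_left algebra_simps)
  moreover have "h d = 1"
    unfolding h_def using d ind \<Delta>_props(3) by (simp add: real_vector.representation_basis)
  ultimately have "h (refl_along d p) < h p" using d by simp
  then have "refl_along d p \<notin> bad" using min by blast
  then obtain qs where qs: "set qs \<subseteq> \<Delta>" "refl_along (refl_along d p) = refl_prod qs"
    using rP by (auto simp: bad_def)
  have "refl_prod (d # qs @ [d]) = refl_along d \<circ> (refl_along (refl_along d p) \<circ> refl_along d)"
    using qs by (simp add: comp_assoc)
  also have "\<dots> = refl_along p"
    using refl_along_conj[OF refl_along_orthogonal, of d p] by (simp add: fun_eq_iff)
  finally have "set (d # qs @ [d]) \<subseteq> \<Delta> \<and> refl_along p = refl_prod (d # qs @ [d])" using qs d by simp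
  then show False using p unfolding bad_def by blast
qed

lemma simple_word:
  assumes "w \<in> W"
  shows "\<exists>qs. set qs \<subseteq> \<Delta> \<and> w = refl_prod qs"
proof -
  obtain qs where "set qs \<subseteq> all_roots" "w = refl_prod qs" using assms W_refl_prod by blast
  moreover have "\<exists>us. set us \<subseteq> \<Delta> \<and> refl_prod qs = refl_prod us" if "set qs \<subseteq> all_roots" for qs
    using that
  proof (induction qs)
    case (Cons q qs)
    then obtain us where us: "set us \<subseteq> \<Delta>" "refl_prod qs = refl_prod us" by auto
    have "q \<in> P \<or> - q \<in> P" using Cons.prems by (simp add: all_roots_def)
    then obtain vs where "set vs \<subseteq> \<Delta>" "refl_along q = refl_prod vs"
      using refl_simple_word[of q] refl_simple_word[of "- q"] by auto
    then have "set (vs @ us) \<subseteq> \<Delta> \<and> refl_prod (q # qs) = refl_prod (vs @ us)" using us by simp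
    then show ?case by blast
  qed (auto intro!: exI[of _ "[]"])
  ultimately show ?thesis by blast
qed

lemma reduced_list:
  assumes "w \<in> W"
  shows "\<exists>qs. set qs \<subseteq> \<Delta> \<and> w = refl_prod qs \<and> length qs = len w"
proof -
  let ?Q = "\<lambda>n. \<exists>ws. set ws \<subseteq> refl_along ` \<Delta> \<and> word_prod ws = w \<and> length ws = n"
  obtain qs where qs: "set qs \<subseteq> \<Delta>" "w = refl_prod qs" using simple_word[OF assms] by blast
  then have "?Q (length qs)" by (intro exI[of _ "map refl_along qs"]) (auto simp: refl_prod_def)
  then have "?Q (len w)" unfolding word_length_def by (rule LeastI)
  then obtain ws where ws: "ws \<in> lists (refl_along ` \<Delta>)" "word_prod ws = w" "length ws = len w" by auto
  then obtain us where "ws = map refl_along us" "set us \<subseteq> \<Delta>" by (auto simp: lists_image)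
  then show ?thesis using ws by (auto simp: refl_prod_def)
qed

text \<open>Exchange deletes a letter from a reduced word.\<close>

lemma len_refl_less:
  assumes "w \<in> W" "t \<in> P" "w t \<notin> P"
  shows "len (w \<circ> refl_along t) < len w"
proof -
  obtain qs where qs: "set qs \<subseteq> \<Delta>" "w = refl_prod qs" "length qs = len w" using reduced_list[OF assms(1)] by blast
  obtain ds where ds: "distinct ds" "set ds = \<Delta>" using finite_distinct_list[OF \<Delta>_props(3)] by blast
  have "t \<in> span (set ds)" using all_roots_span P_all_roots assms ds by blast
  then obtain a s b where "qs = a @ s # b" "w \<circ> refl_along t = refl_prod (a @ b)"
    using exchange[OF simple_list_\<Delta>[OF ds], of qs t] qs assms ds by auto
  then show ?thesis using len_le[of "a @ b"] qs by simp
qed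

text \<open>If w t is positive, then w composed with the reflection in t sends t to a negative root,
  so composing with the reflection once more lowers the length.\<close>

lemma len_refl_less_iff:
  assumes "w \<in> W" "t \<in> P"
  shows "len (w \<circ> refl_along t) < len w \<longleftrightarrow> w t \<notin> P"
proof
  assume less: "len (w \<circ> refl_along t) < len w"
  show "w t \<notin> P"
  proof
    assume wt: "w t \<in> P"
    obtain qs where "set qs \<subseteq> all_roots" "w = refl_prod qs" using assms W_refl_prod by blast
    then have "(w \<circ> refl_along t) t = - w t" by (simp add: linear_neg[OF refl_prod_linear])
    then have "len (w \<circ> refl_along t \<circ> refl_along t) < len (w \<circ> refl_along t)"
      using wt neg assms refl_W P_all_roots group_closed(2)[OF W] by (intro len_refl_less) auto
    moreover have "w \<circ> refl_along t \<circ> refl_along t = w" by (simp add: fun_eq_iff)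
    ultimately show False using less by simp
  qed
qed (use assms len_refl_less in auto)

text \<open>The generating step of \<open>ll\<close> in terms of roots: the drop in Coxeter length
  becomes a sign condition, which can be tested inside a parabolic subsystem.\<close>

definition down :: "('a \<Rightarrow> 'a) \<Rightarrow> ('a \<Rightarrow> 'a) \<Rightarrow> bool" where
  "down v w \<longleftrightarrow> v \<in> W \<and> (\<exists>t\<in>P. w = v \<circ> refl_along t \<and> v t \<notin> P \<and> rk W w = rk W v + 1)"

lemma down_iff: "down v w \<longleftrightarrow> abs_cover W v w \<and> len w < len v"
proof
  assume "down v w"
  then obtain t where t: "v \<in> W" "t \<in> P" "w = v \<circ> refl_along t" "v t \<notin> P" "rk W w = rk W v + 1"
    by (auto simp: down_def)
  moreover have "inv v \<circ> w = refl_along t" using t by (simp add: W_comp_inv_left)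
  ultimately show "abs_cover W v w \<and> len w < len v"
    using len_refl_less_iff[of v t] group_closed(2)[OF W] refl_W rk_refl P_all_roots
    by (auto simp: abs_cover_def abs_le_def)
next
  assume r: "abs_cover W v w \<and> len w < len v"
  then have vw: "v \<in> W" "w \<in> W" "rk W (inv v \<circ> w) = 1" "rk W w = rk W v + 1"
    by (auto simp: abs_cover_def abs_le_def)
  then have "inv v \<circ> w \<in> W" using group_closed[OF W] by simp
  then obtain qs where "set qs \<subseteq> all_roots" "refl_prod qs = inv v \<circ> w" "length qs = 1" using rk_list vw(3) by metis
  then obtain q where q: "q \<in> all_roots" "refl_along q = inv v \<circ> w"
    by (auto simp: length_Suc_conv)
  define t where "t = (if q \<in> P then q else - q)"
  have t: "t \<in> P" "refl_along t = inv v \<circ> w" using q by (auto simp: t_def all_roots_def)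
  have "w = v \<circ> refl_along t" using t vw by (simp add: W_comp_inv_left)
  moreover from this have "v t \<notin> P" using len_refl_less_iff[of v t] t vw r by metis
  ultimately show "down v w" using t vw unfolding down_def by blast
qed

lemma ll_down: "ll W (refl_along ` \<Delta>) = down\<^sup>*\<^sup>*"
proof -
  have "down = (\<lambda>v w. abs_cover W v w \<and> len w < len v)" by (intro ext down_iff)
  then show ?thesis by (simp only: ll_def)
qed

lemma down_abs_le: "down v w \<Longrightarrow> abs_le W v w"
  by (simp add: down_iff abs_cover_def)

lemma down_rtranclp_abs_le: "down\<^sup>*\<^sup>* v w \<Longrightarrow> v \<in> W \<Longrightarrow> abs_le W v w"
  by (induction rule: rtranclp_induct) (auto intro: abs_le_refl abs_le_trans down_abs_le)

end

section \<open>Subwords and sums\<close>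

lemma subseq_set: "subseq qs ks \<Longrightarrow> set qs \<subseteq> set ks"
  by (induction rule: list_emb.induct) auto

lemma subseq_distinct: "subseq qs ks \<Longrightarrow> distinct ks \<Longrightarrow> distinct qs"
proof (induction rule: list_emb.induct)
  case (list_emb_Cons2 x y xs ys)
  then show ?case using subseq_set[of xs ys] by auto
qed auto

lemma subseq_insert_letter:
  assumes "subseq qs ks" "qs \<noteq> ks"
  shows "\<exists>a s b. qs = a @ b \<and> subseq (a @ s # b) ks"
  using assms
proof (induction rule: list_emb.induct)
  case (list_emb_Nil ys)
  then obtain y ys' where "ys = y # ys'" by (cases ys) auto
  then show ?case by (intro exI[of _ "[]"] exI[of _ y]) simp
next
  case (list_emb_Cons xs ys y)
  then show ?case by (intro exI[of _ "[]"] exI[of _ y] exI[of _ xs]) simp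
next
  case (list_emb_Cons2 x y xs ys)
  then obtain a s b where "xs = a @ b" "subseq (a @ s # b) ys" by auto
  then show ?case
    using list_emb_Cons2.hyps by (intro exI[of _ "x # a"] exI[of _ s] exI[of _ b]) simp
qed

lemma subseq_eq_filter:
  assumes "subseq qs ks" "distinct ks"
  shows "qs = filter (\<lambda>x. x \<in> set qs) ks"
  using assms
proof (induction rule: list_emb.induct)
  case (list_emb_Cons xs ys y)
  then have "y \<notin> set xs" using subseq_set by fastforce
  then show ?case using list_emb_Cons by simp
next
  case (list_emb_Cons2 x y xs ys)
  then have "filter (\<lambda>z. z \<in> set (x # xs)) ys = filter (\<lambda>z. z \<in> set xs) ys"
    by (intro filter_cong) auto
  then show ?case using list_emb_Cons2 by simp
qed simp

text \<open>The binomial theorem with subwords in place of subsets. Distinct letters ensure that no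
  subword starting with k is also a subword of the tail.\<close>

lemma sum_subseq_powers:
  fixes x y :: "'r::comm_ring_1" and ks :: "'b list"
  assumes "distinct ks"
  shows "(\<Sum>qs\<in>{qs. subseq qs ks}. x ^ length qs * y ^ (length ks - length qs)) = (x + y) ^ length ks"
  using assms
proof (induction ks)
  case (Cons k ks)
  let ?A = "{qs. subseq qs ks}"
  have fin: "finite ?A" unfolding set_subseqs_eq[symmetric] by (rule List.finite_set)
  have split: "{qs. subseq qs (k # ks)} = ?A \<union> (#) k ` ?A"
    unfolding set_subseqs_eq[symmetric] by (auto simp: Let_def)
  have len: "length qs \<le> length ks" if "qs \<in> ?A" for qs using that list_emb_length by blast
  have kn: "k \<notin> set qs" if "qs \<in> ?A" for qs using that Cons.prems subseq_set[of qs ks] by auto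
  have disj: "?A \<inter> (#) k ` ?A = {}"
  proof (rule ccontr)
    assume "\<not> ?thesis"
    then obtain qs where "k # qs \<in> ?A" by blast
    then show False using kn by fastforce
  qed
  have "(\<Sum>qs\<in>{qs. subseq qs (k # ks)}. x ^ length qs * y ^ (length (k # ks) - length qs)) =
      (\<Sum>qs\<in>?A. x ^ length qs * y ^ (Suc (length ks) - length qs)) +
      (\<Sum>qs\<in>?A. x ^ Suc (length qs) * y ^ (length ks - length qs))"
    unfolding split using fin disj by (subst sum.union_disjoint) (auto simp: sum.reindex)
  also have "(\<Sum>qs\<in>?A. x ^ length qs * y ^ (Suc (length ks) - length qs)) =
      y * (\<Sum>qs\<in>?A. x ^ length qs * y ^ (length ks - length qs))"
    unfolding sum_distrib_left
  proof (rule sum.cong[OF refl])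
    fix qs assume "qs \<in> ?A"
    then have "Suc (length ks) - length qs = Suc (length ks - length qs)" using len Suc_diff_le by blast
    then show "x ^ length qs * y ^ (Suc (length ks) - length qs) =
      y * (x ^ length qs * y ^ (length ks - length qs))" by (simp add: ac_simps)
  qed
  also have "(\<Sum>qs\<in>?A. x ^ Suc (length qs) * y ^ (length ks - length qs)) =
      x * (\<Sum>qs\<in>?A. x ^ length qs * y ^ (length ks - length qs))"
    unfolding sum_distrib_left by (intro sum.cong) (simp_all add: ac_simps)
  finally show ?case using Cons by (simp add: distrib_right)
next
  case Nil
  have "{qs :: 'b list. subseq qs []} = {[]}" by auto
  then show ?case by simp
qed

lemma sum_related_pairs:
  assumes "finite N"
  shows "(\<Sum>(a, b)\<in>{(a, b). a \<in> N \<and> b \<in> N \<and> R a b}. f a b) = (\<Sum>b\<in>N. \<Sum>a\<in>{a \<in> N. R a b}. f a b)"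
proof -
  have "(\<Sum>b\<in>N. \<Sum>a\<in>{a \<in> N. R a b}. f a b) = (\<Sum>(b, a)\<in>Sigma N (\<lambda>b. {a \<in> N. R a b}). f a b)"
    using assms by (subst sum.Sigma) auto
  also have "\<dots> = (\<Sum>(a, b)\<in>{(a, b). a \<in> N \<and> b \<in> N \<and> R a b}. f a b)"
    by (rule sum.reindex_bij_witness[of _ prod.swap prod.swap]) auto
  finally show ?thesis by simp
qed

section \<open>Intervals of the order\<close>

context positive_system
begin

lemma simple_list_delete:
  assumes "simple_list (a @ s # b)"
  shows "refl_prod (a @ s # b) \<circ> refl_along (refl_prod (rev b) s) = refl_prod (a @ b)" "refl_prod (a @ s # b) (refl_prod (rev b) s) \<notin> P"
proof -
  show "refl_prod (a @ s # b) \<circ> refl_along (refl_prod (rev b) s) = refl_prod (a @ b)"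
    using refl_prod_conj[of b "refl_prod (rev b) s"] by (auto simp: fun_eq_iff)
  have "refl_prod (a @ s # b) (refl_prod (rev b) s) = - refl_prod a s" by (simp add: linear_neg[OF refl_prod_linear])
  then show "refl_prod (a @ s # b) (refl_prod (rev b) s) \<notin> P" using simple_list_split_pos(1)[OF assms] neg by simp
qed

lemma simple_list_subseq: "simple_list ks \<Longrightarrow> subseq qs ks \<Longrightarrow> simple_list qs"
  using simple_list_sub simple_list_D(1) subseq_distinct subseq_set by blast

lemma simple_list_span_mem:
  assumes "simple_list rs" "set qs \<subseteq> set rs" "q \<in> set rs" "q \<in> span (set qs)"
  shows "q \<in> set qs"
proof (rule ccontr)
  assume n: "q \<notin> set qs"
  have "independent (insert q (set qs))"
    using independent_mono[OF simple_list_D(3)[OF assms(1)]] assms by simp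
  then show False using n assms(4) by (simp add: independent_insert)
qed

text \<open>The product determines the span of the letters, and a letter of ks lies in the span of a
  subword only if it occurs in it. Distinctness then recovers a subword from its set of
  letters.\<close>

lemma simple_list_subseq_inj:
  assumes "simple_list ks" "subseq qs ks" "subseq qs' ks" "refl_prod qs = refl_prod qs'"
  shows "qs = qs'"
proof -
  have sub: "set qs \<subseteq> set ks" "set qs' \<subseteq> set ks" using assms subseq_set by blast+
  note D = simple_list_D[OF simple_list_subseq[OF assms(1,2)]] and D' = simple_list_D[OF simple_list_subseq[OF assms(1,3)]]
  have "set qs = set qs'"
  proof
    show "set qs \<subseteq> set qs'"
    proof
      fix x assume x: "x \<in> set qs"
      then have "x \<in> span (set qs')" using refl_prod_span_le[OF D(1,3) assms(4)[symmetric]] span_base by blast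
      then show "x \<in> set qs'" using simple_list_span_mem[OF assms(1) sub(2)] x sub by blast
    qed
    show "set qs' \<subseteq> set qs"
    proof
      fix x assume x: "x \<in> set qs'"
      then have "x \<in> span (set qs)" using refl_prod_span_le[OF D'(1,3) assms(4)] span_base by blast
      then show "x \<in> set qs" using simple_list_span_mem[OF assms(1) sub(1)] x sub by blast
    qed
  qed
  then show ?thesis using subseq_eq_filter assms simple_list_D(1) by metis
qed

end

context coxeter_group
begin

lemma abs_le_mem: "abs_le W v w \<Longrightarrow> v \<in> W"
  by (simp add: abs_le_def)

text \<open>The complement of v in the smaller element is \<open>refl_prod ks\<close> composed with
  the reflection in t, a coatom below \<open>refl_prod ks\<close>, so the ranks add up.\<close>

lemma abs_le_refl_comp:
  assumes rs: "simple_list rs" and v: "abs_le W v (refl_prod rs)" and ks: "simple_list ks" "refl_prod ks = inv v \<circ> refl_prod rs"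
    and t: "t \<in> all_roots" "t \<in> span (set ks)"
    and rs': "simple_list rs'" "refl_prod rs' = refl_prod rs \<circ> refl_along t" "length rs = Suc (length rs')"
  shows "abs_le W v (refl_prod rs')"
proof -
  obtain us where us: "simple_list us" "refl_prod us = v" using abs_le_simple_list[OF v rs] by blast
  have len: "length us + length ks = length rs"
    using v rk_simple_list[OF rs] rk_simple_list[OF us(1)] rk_simple_list[OF ks(1)] us ks by (simp add: abs_le_def)
  obtain ks' where ks': "simple_list ks'" "length ks = Suc (length ks')" "refl_prod ks' = refl_prod ks \<circ> refl_along t"
    using simple_coatom_all_roots[OF ks(1) t] unfolding simple_coatom_def by blast
  have "refl_prod ks' = inv v \<circ> refl_prod rs'" using ks' ks(2) rs'(2) by (simp add: comp_assoc)
  then show ?thesis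
    using us ks' rs'(3) len rk_simple_list[OF rs'(1)] simple_list_D(4) W_I[OF simple_list_D(4)[OF rs'(1)]]
    by (intro abs_leI[of us ks']) simp_all
qed

text \<open>The vector f fixed by \<open>refl_prod rs'\<close> is orthogonal to the span of rs',
  hence fixed by \<open>refl_prod vs\<close>. So the inverses of \<open>refl_prod rs\<close> and
  \<open>refl_prod ks\<close> move f by the same amount, namely -t, which puts t into the span of
  ks.\<close>

lemma deleted_root_in_complement:
  assumes rs: "simple_list rs" and v: "simple_list vs" "set vs \<subseteq> span (set rs')"
    and ks: "refl_prod rs = refl_prod vs \<circ> refl_prod ks"
    and t: "t \<in> all_roots" "t \<in> span (set rs)"
    and rs': "simple_list rs'" "refl_prod rs' = refl_prod rs \<circ> refl_along t"
  shows "t \<in> span (set ks)"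
proof -
  obtain f where f: "f - refl_prod (rev rs) f = t" "refl_prod rs (refl_along t f) = f"
    using refl_prod_solve_unit[OF simple_list_D(1,3)[OF rs] t(2) all_roots_unit[OF t(1)]] by metis
  have "refl_prod rs' f = f" using f rs' by simp
  then have "f \<bullet> q = 0" if "q \<in> set rs'" for q
    using refl_prod_fixed_orth[OF simple_list_D(1,3)[OF rs'(1)]] that by blast
  then have "f \<bullet> q = 0" if "q \<in> span (set rs')" for q
    using orthogonal_to_span[OF that, of f] by (auto simp: orthogonal_def)
  then have "refl_prod vs f = f" using v(2) by (intro refl_prod_orth_fixed) auto
  then have vf: "refl_prod (rev vs) f = f" by (metis refl_prod_rev(1))
  have "refl_prod rs = refl_prod (vs @ ks)" using ks by simp
  then have "refl_prod (rev rs) = refl_prod (rev (vs @ ks))" by (metis inv_refl_prod)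
  then have "refl_prod (rev rs) f = refl_prod (rev ks) f" using vf by simp
  then have "t = - (refl_prod (rev ks) f - f)" using f(1) by simp
  then show ?thesis using refl_prod_diff_span[of "rev ks" f] by (metis set_rev span_neg)
qed

text \<open>A root \<open>u\<close> with \<open>u > 0 > v u\<close> has zero coordinate at every simple root outside
  the support of \<open>v\<close>, because \<open>v u - u\<close> does.\<close>

lemma down_le_parabolic:
  assumes rs: "simple_list (a @ s # b)" and t: "t \<in> all_roots" "t \<in> span (set (a @ s # b))"
    "refl_prod (a @ b) = refl_prod (a @ s # b) \<circ> refl_along t"
    and \<alpha>: "abs_le W \<alpha> (refl_prod (a @ b))"
    and \<beta>: "down\<^sup>*\<^sup>* \<alpha> \<beta>" "abs_le W \<beta> (refl_prod (a @ s # b))"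
  shows "abs_le W \<beta> (refl_prod (a @ b))"
  using \<beta>
proof (induction rule: rtranclp_induct)
  case (step \<gamma> \<beta>)
  let ?R = "set (a @ s # b)" and ?R' = "set (a @ b)"
  note D = simple_list_D[OF rs]
  have R: "?R = insert s ?R'" by auto
  have sR: "s \<notin> ?R'" using D(1) by auto
  have rs': "simple_list (a @ b)" by (rule simple_list_sub[OF rs]) (use D in auto)
  have \<gamma>\<beta>: "abs_le W \<gamma> \<beta>" using step.hyps(2) by (rule down_abs_le)
  then have \<gamma>: "abs_le W \<gamma> (refl_prod (a @ b))" using step.IH step.prems abs_le_trans by blast
  obtain gs where gs: "simple_list gs" "refl_prod gs = \<gamma>" "set gs \<subseteq> span ?R'"
    using abs_le_lists[OF \<gamma> rs'] by metis
  obtain bs ks where bs: "simple_list bs" "refl_prod bs = \<beta>" "set bs \<subseteq> span ?R"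
    and ks: "simple_list ks" "refl_prod ks = inv \<beta> \<circ> refl_prod (a @ s # b)"
    using abs_le_lists[OF step.prems rs] by metis
  obtain u where u: "u \<in> P" "\<beta> = \<gamma> \<circ> refl_along u" "\<gamma> u \<notin> P" "rk W \<beta> = rk W \<gamma> + 1" and \<gamma>W: "\<gamma> \<in> W"
    using step.hyps(2) by (auto simp: down_def)
  have urt: "u \<in> all_roots" using u by (rule_tac P_all_roots)
  \<comment> \<open>Both are words for \<beta> whose length is its rank, so they have the same span.
    This first places u in the span of the large system and, once its coordinate at s vanishes,
    places bs in the span of a @ b.\<close>
  have eq: "refl_prod (gs @ [u]) = refl_prod bs" using gs bs u by simp
  have len: "length (gs @ [u]) = length bs" using rk_simple_list[OF gs(1)] rk_simple_list[OF bs(1)] gs bs u by simp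
  have sp: "span (set (gs @ [u])) = span (set bs)" by (rule refl_prod_same_length(3)[OF simple_list_D(1,3)[OF bs(1)] eq len])
  have "u \<in> span (set bs)" unfolding sp[symmetric] by (simp add: span_base)
  then have uR: "u \<in> span ?R" using span_minimal[OF bs(3) subspace_span] by blast
  have gsR: "set gs \<subseteq> span ?R" using gs(3) span_mono[of ?R' ?R] R by blast
  have \<gamma>uR: "\<gamma> u \<in> span ?R" using refl_prod_in_span[OF gsR uR] gs by simp
  have "- \<gamma> u \<in> P" using refl_prod_all_roots[OF simple_list_D(4)[OF gs(1)] urt] gs(2) u(3) all_roots_not_P by simp
  then have 1: "0 \<le> representation ?R (- \<gamma> u) s" using D(5) \<gamma>uR span_neg by blast
  have 2: "0 \<le> representation ?R u s" using D(5)[OF u(1) uR] .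
  have d: "\<gamma> u - u \<in> span ?R'"
    using refl_prod_diff_span[of gs u] gs span_minimal[OF gs(3) subspace_span] by auto
  have "representation ?R (\<gamma> u - u) s = representation ?R' (\<gamma> u - u) s"
    using real_vector.representation_extend[OF D(3) d] R by (metis subset_insertI)
  also have "\<dots> = 0" using sR real_vector.representation_ne_zero by metis
  finally have "representation ?R (\<gamma> u) s - representation ?R u s = 0"
    using real_vector.representation_diff[OF D(3) uR \<gamma>uR] by simp
  moreover have "representation ?R (- \<gamma> u) s = - representation ?R (\<gamma> u) s"
    using real_vector.representation_neg[OF D(3) \<gamma>uR] by simp
  ultimately have 0: "representation ?R u s = 0" using 1 2 by simp
  have "u = (\<Sum>d\<in>?R. representation ?R u d *\<^sub>R d)"
    using real_vector.sum_representation_eq[OF D(3) uR List.finite_set subset_refl] by simp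
  also have "\<dots> = (\<Sum>d\<in>?R'. representation ?R u d *\<^sub>R d)"
    using 0 unfolding R by (intro sum.mono_neutral_right) auto
  also have "\<dots> \<in> span ?R'" by (intro span_sum span_scale span_base)
  finally have "set (gs @ [u]) \<subseteq> span ?R'" using gs(3) by simp
  then have "span (set bs) \<subseteq> span ?R'" unfolding sp[symmetric] by (simp add: span_minimal)
  then have bsR: "set bs \<subseteq> span ?R'" using span_superset by blast
  have \<beta>W: "\<beta> \<in> W" using step.prems by (simp add: abs_le_def)
  \<comment> \<open>Now \<beta> belongs to the subsystem of a @ b, so the deleted root t lies in the
    span of its complement and can be split off there.\<close>
  have "refl_prod (a @ s # b) = refl_prod bs \<circ> refl_prod ks" unfolding ks bs(2) using \<beta>W by (simp only: W_comp_inv_left)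
  then have "t \<in> span (set ks)"
    by (rule deleted_root_in_complement[OF rs bs(1) bsR _ t(1,2) rs' t(3)])
  then show ?case
    by (intro abs_le_refl_comp[OF rs step.prems ks t(1) _ rs' t(3)]) auto
qed (rule \<alpha>)

text \<open>If \<open>\<delta>\<close> is minimal in its coset of the group generated by the noncrossing complement
  \<open>refl_prod ks\<close> of \<open>\<alpha>\<close>, then the elements above \<open>\<alpha>\<close> and below \<open>\<delta>\<close> form a Boolean lattice.\<close>

lemma down_interval:
  assumes rs: "simple_list rs" and \<alpha>: "abs_le W \<alpha> (refl_prod rs)" and ks: "simple_list ks" "refl_prod ks = inv \<alpha> \<circ> refl_prod rs"
    and pos: "\<And>t. t \<in> P \<Longrightarrow> t \<in> span (set ks) \<Longrightarrow> refl_prod rs t \<in> P"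
  shows "{\<beta>. down\<^sup>*\<^sup>* \<alpha> \<beta> \<and> abs_le W \<beta> (refl_prod rs)} = (\<lambda>qs. refl_prod rs \<circ> refl_prod (rev qs)) ` {qs. subseq qs ks}" (is "?L = ?R")
    and "subseq qs ks \<Longrightarrow> rk W (refl_prod rs \<circ> refl_prod (rev qs)) + length qs = length rs"
proof -
  have \<alpha>W: "\<alpha> \<in> W" and \<delta>W: "refl_prod rs \<in> W" using \<alpha> by (auto simp: abs_le_def)
  have "refl_prod rs = \<alpha> \<circ> refl_prod ks" unfolding ks(2) using \<alpha>W by (simp only: W_comp_inv_left)
  then have \<alpha>eq: "refl_prod rs \<circ> refl_prod (rev ks) = \<alpha>" by (simp add: fun_eq_iff)
  have sub: "simple_list qs \<and> span (set qs) \<subseteq> span (set ks)" if "subseq qs ks" for qs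
    using simple_list_subseq[OF ks(1) that] span_mono[of "set qs" "set ks"] subseq_set[OF that] by blast
  have cancel: "(refl_prod rs \<circ> refl_prod (rev qs)) \<circ> refl_prod qs = refl_prod rs" for qs by (simp add: fun_eq_iff)
  have W': "refl_prod rs \<circ> refl_prod (rev qs) \<in> W" if "subseq qs ks" for qs
    using sub[OF that] simple_list_D(4) W_I[of "rev qs"] group_closed(2)[OF W] \<delta>W by auto
  \<comment> \<open>The case qs = ks gives \<alpha>; letters are then removed one at a time.
    Removing s from a @ s # b is right multiplication by the reflection in
    \<open>refl_prod a s\<close>. The element before removal sends this root to minus the image of
    the positive root \<open>refl_prod (rev b) s\<close> under \<open>refl_prod rs\<close>, which is
    negative by \<open>pos\<close>.\<close>
  have claim: "down\<^sup>*\<^sup>* \<alpha> (refl_prod rs \<circ> refl_prod (rev qs)) \<and> rk W (refl_prod rs \<circ> refl_prod (rev qs)) + length qs = length rs"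
    if "subseq qs ks" for qs
    using that
  proof (induction "length ks - length qs" arbitrary: qs rule: less_induct)
    case less
    show ?case
    proof (cases "qs = ks")
      case True
      then show ?thesis using \<alpha>eq \<alpha> rk_simple_list[OF rs] rk_simple_list[OF ks(1)] ks by (simp add: abs_le_def)
    next
      case False
      then obtain a s b where asb: "qs = a @ b" "subseq (a @ s # b) ks"
        using subseq_insert_letter less.prems by blast
      let ?\<gamma> = "refl_prod rs \<circ> refl_prod (rev (a @ s # b))" and ?\<beta> = "refl_prod rs \<circ> refl_prod (rev qs)"
      have "length (a @ s # b) \<le> length ks" using asb(2) by (rule list_emb_length)
      then have "length ks - length (a @ s # b) < length ks - length qs" using asb(1) by simp
      then have IH: "down\<^sup>*\<^sup>* \<alpha> ?\<gamma>" "rk W ?\<gamma> + length (a @ s # b) = length rs"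
        using less.hyps asb(2) by blast+
      have simple_list: "simple_list (a @ s # b)" "span (set (a @ s # b)) \<subseteq> span (set ks)" using sub[OF asb(2)] by auto
      note sp = simple_list_split_pos[OF simple_list(1)]
      define t where "t = refl_prod a s"
      have t: "t \<in> P" "t \<in> all_roots" using sp(1) P_all_roots by (simp_all add: t_def)
      have "refl_prod (rev a) (refl_along t v) = refl_along s (refl_prod (rev a) v)" for v
        using refl_prod_conj[of a s] unfolding t_def by (metis comp_apply refl_prod_rev)
      then have \<beta>: "?\<beta> = ?\<gamma> \<circ> refl_along t" by (simp add: asb fun_eq_iff)
      have "?\<gamma> t = - refl_prod rs (refl_prod (rev b) s)" by (simp add: t_def linear_neg[OF refl_prod_linear])
      moreover have "refl_prod rs (refl_prod (rev b) s) \<in> P" using pos sp(2,5) simple_list(2) by blast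
      ultimately have neg\<gamma>: "?\<gamma> t \<notin> P" using neg by simp
      have \<beta>W: "?\<beta> \<in> W" using W' less.prems .
      have \<gamma>W: "?\<gamma> \<in> W" using W' asb(2) .
      \<comment> \<open>The rank is squeezed: it rises by at most one, and the remaining letters of
        qs must make up the difference to \<open>length rs\<close>.\<close>
      have "rk W ?\<beta> \<le> rk W ?\<gamma> + 1"
        unfolding \<beta> using rk_comp_le[OF W \<gamma>W refl_W[OF t(2)]] rk_refl[OF t(2)] by simp
      moreover have qsrt: "set qs \<subseteq> all_roots" using sub[OF less.prems] simple_list_D(4) by blast
      have "rk W (refl_prod rs) \<le> rk W ?\<beta> + length qs"
        using rk_comp_le[OF W \<beta>W W_I[OF qsrt]] rk_refl_prod_le[OF qsrt] unfolding cancel by simp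
      ultimately have rk\<beta>: "rk W ?\<beta> = rk W ?\<gamma> + 1" "rk W ?\<beta> + length qs = length rs"
        using IH(2) rk_simple_list[OF rs] asb(1) by simp_all
      have "down ?\<gamma> ?\<beta>" unfolding down_def using \<gamma>W t(1) \<beta> neg\<gamma> rk\<beta>(1) by blast
      then show ?thesis using IH(1) rk\<beta>(2) by (meson rtranclp.rtrancl_into_rtrancl)
    qed
  qed
  then show "subseq qs ks \<Longrightarrow> rk W (refl_prod rs \<circ> refl_prod (rev qs)) + length qs = length rs" by blast
  have inv_eq: "inv (refl_prod rs \<circ> refl_prod (rev qs)) \<circ> refl_prod rs = refl_prod qs" if "subseq qs ks" for qs
    using W_comp_inv_left(1)[OF W'[OF that], of "refl_prod qs"] unfolding cancel .
  show "?L = ?R"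
  proof
    show "?R \<subseteq> ?L"
    proof
      fix \<beta> assume "\<beta> \<in> ?R"
      then obtain qs where qs: "subseq qs ks" "\<beta> = refl_prod rs \<circ> refl_prod (rev qs)" by blast
      then have "abs_le W \<beta> (refl_prod rs)"
        unfolding abs_le_def
        using claim[OF qs(1)] W'[OF qs(1)] \<delta>W inv_eq[OF qs(1)] rk_simple_list[OF rs] rk_simple_list sub[OF qs(1)] by simp
      then show "\<beta> \<in> ?L" using claim qs by simp
    qed
    show "?L \<subseteq> ?R"
    proof
      fix \<beta> assume "\<beta> \<in> ?L"
      then have "down\<^sup>*\<^sup>* \<alpha> \<beta>" "abs_le W \<beta> (refl_prod rs)" by auto
      then show "\<beta> \<in> ?R"
      proof (induction rule: rtranclp_induct)
        case base
        then show ?case using \<alpha>eq by (intro image_eqI[of _ _ ks]) auto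
      next
        case (step \<gamma> \<beta>)
        have "abs_le W \<gamma> \<beta>" using step.hyps(2) by (rule down_abs_le)
        then have \<gamma>le: "abs_le W \<gamma> (refl_prod rs)" using step.prems abs_le_trans by blast
        then obtain qs where qs: "subseq qs ks" "\<gamma> = refl_prod rs \<circ> refl_prod (rev qs)" using step.IH by blast
        have qsSC: "simple_list qs" "span (set qs) \<subseteq> span (set ks)" using sub[OF qs(1)] by auto
        obtain u where u: "u \<in> P" "\<beta> = \<gamma> \<circ> refl_along u" "\<gamma> u \<notin> P" "rk W \<beta> = rk W \<gamma> + 1" and \<gamma>W: "\<gamma> \<in> W"
          using step.hyps(2) by (auto simp: down_def)
        obtain bs where bs: "simple_list bs" "refl_prod bs = inv \<beta> \<circ> refl_prod rs"
          using abs_le_lists[OF step.prems rs] by metis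
        have \<beta>W: "\<beta> \<in> W" using step.prems by (simp add: abs_le_def)
        \<comment> \<open>Both u # bs and qs are words of minimal length for the complement of
          \<gamma>, so u lies in the span of qs.\<close>
        have "\<gamma> \<circ> refl_prod (u # bs) = \<beta> \<circ> refl_prod bs" using u by (simp add: comp_assoc)
        also have "\<dots> = refl_prod rs" unfolding bs using \<beta>W by (simp only: W_comp_inv_left)
        finally have "inv \<gamma> \<circ> refl_prod rs = refl_prod (u # bs)" using \<gamma>W W_comp_inv_left(1) by metis
        then have eq: "refl_prod (u # bs) = refl_prod qs" using inv_eq[OF qs(1)] qs(2) by simp
        have "rk W (refl_prod rs) = rk W \<beta> + length bs" using step.prems bs rk_simple_list[OF bs(1)] by (simp add: abs_le_def)
        then have "length (u # bs) = length qs"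
          using claim[OF qs(1)] qs(2) u(4) rk_simple_list[OF rs] by simp
        then have "span (set (u # bs)) = span (set qs)"
          using refl_prod_same_length(3)[OF simple_list_D(1,3)[OF qsSC(1)] eq] by blast
        then have uqs: "u \<in> span (set qs)" using span_base[of u "set (u # bs)"] by simp
        \<comment> \<open>Since \<open>refl_prod rs\<close> keeps positive roots in the span of ks
          positive, u must already turn negative under \<open>refl_prod (rev qs)\<close>, where
          exchange deletes a letter.\<close>
        have "refl_prod (rev qs) u \<notin> P"
        proof
          assume "refl_prod (rev qs) u \<in> P"
          moreover have "refl_prod (rev qs) u \<in> span (set qs)" using uqs by (intro refl_prod_in_span) (auto intro: span_base)
          ultimately have "refl_prod rs (refl_prod (rev qs) u) \<in> P" using pos qsSC(2) by blast
          then show False using u(3) qs(2) by simp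
        qed
        then obtain a s b where asb: "rev qs = a @ s # b" "refl_prod (rev qs) \<circ> refl_along u = refl_prod (a @ b)"
          using exchange[OF qsSC(1) _ u(1) uqs, of "rev qs"] by auto
        have q: "qs = rev b @ s # rev a" using asb(1) by (metis append.assoc append_Cons append_Nil rev.simps(2) rev_append rev_rev_ident)
        have "subseq (rev b @ rev a) qs" unfolding q by (rule list_emb_append_mono) auto
        then have "subseq (rev b @ rev a) ks" using qs(1) subseq_order.order_trans by blast
        moreover have "\<beta> = refl_prod rs \<circ> refl_prod (rev (rev b @ rev a))"
          using u(2) qs(2) asb(2) by (simp add: comp_assoc)
        ultimately show ?case by blast
      qed
    qed
  qed
qed

section \<open>The alternating sum and the two convolutions\<close>

lemma alternating_down_sum:
  assumes "simple_list rs" "abs_le W \<alpha> (refl_prod rs)"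
  shows "(\<Sum>\<beta>\<in>{\<beta>. down\<^sup>*\<^sup>* \<alpha> \<beta> \<and> abs_le W \<beta> (refl_prod rs)}. (- 1) ^ rk W \<beta> :: int) =
    (if \<alpha> \<in> refl_prod ` {qs. subseq qs rs} then (- 1) ^ rk W \<alpha> else 0)"
  using assms
proof (induction "length rs" arbitrary: rs rule: less_induct)
  case less
  note D = simple_list_D[OF less.prems(1)]
  obtain us ks where us: "simple_list us" "refl_prod us = \<alpha>" and ks: "simple_list ks" "refl_prod ks = inv \<alpha> \<circ> refl_prod rs" "set ks \<subseteq> span (set rs)"
    using abs_le_lists[OF less.prems(2,1)] by metis
  have \<alpha>W: "\<alpha> \<in> W" using less.prems(2) by (simp add: abs_le_def)
  have rs_us_ks: "refl_prod rs = refl_prod us \<circ> refl_prod ks" unfolding ks(2) us(2) using \<alpha>W by (simp only: W_comp_inv_left)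
  show ?case
  proof (cases "\<exists>t\<in>P. t \<in> span (set ks) \<and> refl_prod rs t \<notin> P")
    case True
    then obtain t where t: "t \<in> P" "t \<in> span (set ks)" "refl_prod rs t \<notin> P" by blast
    have trs: "t \<in> span (set rs)" using t(2) span_minimal[OF ks(3) subspace_span] by blast
    obtain a s b where asb: "rs = a @ s # b" "refl_prod rs \<circ> refl_along t = refl_prod (a @ b)"
      using exchange[OF less.prems(1) subset_refl t(1) trs t(3)] by blast
    have simple_list': "simple_list (a @ b)" by (rule simple_list_sub[OF less.prems(1)]) (use D(1) asb(1) in auto)
    have \<alpha>': "abs_le W \<alpha> (refl_prod (a @ b))"
      using abs_le_refl_comp[OF less.prems ks(1,2) P_all_roots[OF t(1)] t(2) simple_list'] asb by simp
    have "refl_prod rs = refl_prod (a @ b) \<circ> refl_along t" unfolding asb(2)[symmetric] by (simp add: fun_eq_iff)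
    then have "abs_le W (refl_prod (a @ b)) (refl_prod rs)"
      using t(1) P_all_roots[OF t(1)] W_I[OF simple_list_D(4)[OF simple_list']] W_I[OF D(4)] rk_refl rk_simple_list[OF less.prems(1)] rk_simple_list[OF simple_list'] asb(1)
      by (simp add: abs_le_def W_comp_inv_left)
    then have "{\<beta>. down\<^sup>*\<^sup>* \<alpha> \<beta> \<and> abs_le W \<beta> (refl_prod rs)} = {\<beta>. down\<^sup>*\<^sup>* \<alpha> \<beta> \<and> abs_le W \<beta> (refl_prod (a @ b))}"
      using down_le_parabolic[OF less.prems(1)[unfolded asb(1)] P_all_roots[OF t(1)] trs[unfolded asb(1)]
          asb(2)[symmetric, unfolded asb(1)] \<alpha>'] abs_le_trans asb(1) by blast
    \<comment> \<open>Passing to a @ b loses no subword with product \<alpha>: its letters lie in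
      the span of a @ b, which does not contain s.\<close>
    moreover have "\<alpha> \<in> refl_prod ` {qs. subseq qs rs} \<longleftrightarrow> \<alpha> \<in> refl_prod ` {qs. subseq qs (a @ b)}"
    proof
      assume "\<alpha> \<in> refl_prod ` {qs. subseq qs (a @ b)}"
      moreover have "subseq (a @ b) rs" unfolding asb(1) by (rule list_emb_append_mono) auto
      ultimately show "\<alpha> \<in> refl_prod ` {qs. subseq qs rs}" using subseq_order.order_trans by blast
    next
      assume "\<alpha> \<in> refl_prod ` {qs. subseq qs rs}"
      then obtain qs where qs: "subseq qs rs" "\<alpha> = refl_prod qs" by blast
      obtain vs where vs: "simple_list vs" "refl_prod vs = \<alpha>" "set vs \<subseteq> span (set (a @ b))"
        using abs_le_lists[OF \<alpha>' simple_list'] by metis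
      note Q = simple_list_D[OF simple_list_subseq[OF less.prems(1) qs(1)]]
      have "span (set qs) \<subseteq> span (set vs)" using refl_prod_span_le[OF Q(1,3), of vs] vs qs by simp
      then have "set qs \<subseteq> span (set (a @ b))"
        using span_minimal[OF vs(3) subspace_span] span_superset by blast
      then have "s \<notin> set qs" using simple_list_split_pos(3)[OF less.prems(1)[unfolded asb(1)]] by blast
      then have "qs = filter (\<lambda>x. x \<in> set qs) (a @ b)"
        using subseq_eq_filter[OF qs(1) D(1)] asb(1) by simp
      then have "subseq qs (a @ b)" by (metis subseq_filter_left)
      then show "\<alpha> \<in> refl_prod ` {qs. subseq qs (a @ b)}" using qs(2) by blast
    qed
    ultimately show ?thesis using less.hyps[OF _ simple_list' \<alpha>'] asb(1) by simp
  next
    case False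
    then have pos: "\<And>t. t \<in> P \<Longrightarrow> t \<in> span (set ks) \<Longrightarrow> refl_prod rs t \<in> P" by blast
    have int: "{\<beta>. down\<^sup>*\<^sup>* \<alpha> \<beta> \<and> abs_le W \<beta> (refl_prod rs)} = (\<lambda>qs. refl_prod rs \<circ> refl_prod (rev qs)) ` {qs. subseq qs ks}"
      by (rule down_interval(1)[OF less.prems ks(1,2)]) (rule pos)
    have rk_int: "rk W (refl_prod rs \<circ> refl_prod (rev qs)) + length qs = length rs" if "subseq qs ks" for qs
      by (rule down_interval(2)[OF less.prems ks(1,2) _ that]) (rule pos)
    have inj: "inj_on (\<lambda>qs. refl_prod rs \<circ> refl_prod (rev qs)) {qs. subseq qs ks}"
    proof (rule inj_onI)
      fix qs qs' assume q: "qs \<in> {qs. subseq qs ks}" "qs' \<in> {qs. subseq qs ks}"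
        and eq: "refl_prod rs \<circ> refl_prod (rev qs) = refl_prod rs \<circ> refl_prod (rev qs')"
      then have "refl_prod (rev qs) = refl_prod (rev qs')" by (metis comp_assoc comp_id id_comp refl_prod_rev_comp(1))
      then have "refl_prod qs = refl_prod qs'" by (metis inv_refl_prod rev_rev_ident)
      then show "qs = qs'" using simple_list_subseq_inj[OF ks(1)] q by blast
    qed
    have "(\<Sum>\<beta>\<in>{\<beta>. down\<^sup>*\<^sup>* \<alpha> \<beta> \<and> abs_le W \<beta> (refl_prod rs)}. (- 1) ^ rk W \<beta> :: int) =
      (\<Sum>qs\<in>{qs. subseq qs ks}. (- 1) ^ rk W (refl_prod rs \<circ> refl_prod (rev qs)))"
      unfolding int by (simp add: sum.reindex[OF inj])
    \<comment> \<open>The power of 1 is inserted to match the binomial sum, which then evaluates to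
      a power of -1 + 1.\<close>
    also have "\<dots> = (\<Sum>qs\<in>{qs. subseq qs ks}. (- 1) ^ length rs * ((- 1) ^ length qs * 1 ^ (length ks - length qs)))"
    proof (rule sum.cong[OF refl])
      fix qs assume "qs \<in> {qs. subseq qs ks}"
      then have "length rs = rk W (refl_prod rs \<circ> refl_prod (rev qs)) + length qs" using rk_int by simp
      then have "(- 1) ^ length rs * (- 1) ^ length qs = (- 1 :: int) ^ rk W (refl_prod rs \<circ> refl_prod (rev qs)) * ((- 1) ^ length qs * (- 1) ^ length qs)"
        by (simp add: power_add)
      then show "(- 1) ^ rk W (refl_prod rs \<circ> refl_prod (rev qs)) =
        (- 1 :: int) ^ length rs * ((- 1) ^ length qs * 1 ^ (length ks - length qs))"
        by (simp flip: power_mult_distrib)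
    qed
    also have "\<dots> = (- 1) ^ length rs * (- 1 + 1) ^ length ks"
      unfolding sum_distrib_left[symmetric] sum_subseq_powers[OF simple_list_D(1)[OF ks(1)]] ..
    also have "\<dots> = (if ks = [] then (- 1) ^ length rs else 0)" by (cases ks) auto
    finally have sum: "(\<Sum>\<beta>\<in>{\<beta>. down\<^sup>*\<^sup>* \<alpha> \<beta> \<and> abs_le W \<beta> (refl_prod rs)}. (- 1) ^ rk W \<beta> :: int) =
      (if ks = [] then (- 1) ^ length rs else 0)" .
    show ?thesis
    proof (cases "ks = []")
      case True
      then have "\<alpha> = refl_prod rs" using rs_us_ks us by simp
      then show ?thesis using sum True rk_simple_list[OF less.prems(1)] by auto
    next
      case nonempty: False
      \<comment> \<open>A proper subword misses some letter s. The positive root whose reflection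
        deletes s is made negative by \<open>refl_prod rs\<close> and lies in the span of the
        complement, against the assumption of this case.\<close>
      have "\<alpha> \<notin> refl_prod ` {qs. subseq qs rs}"
      proof
        assume "\<alpha> \<in> refl_prod ` {qs. subseq qs rs}"
        then obtain qs where qs: "subseq qs rs" "\<alpha> = refl_prod qs" by blast
        have "length qs + length ks = length rs"
          using less.prems(2) qs rk_simple_list[OF simple_list_subseq[OF less.prems(1) qs(1)]] rk_simple_list[OF less.prems(1)] rk_simple_list[OF ks(1)] ks(2)
          by (simp add: abs_le_def)
        then have "qs \<noteq> rs" using nonempty by auto
        then obtain s where s: "s \<in> set rs" "s \<notin> set qs"
          using subseq_eq_filter[OF qs(1) D(1)] by (metis filter_True)
        then obtain a b where asb: "rs = a @ s # b" by (meson split_list)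
        note simple_list = less.prems(1)[unfolded asb]
        define t where "t = refl_prod (rev b) s"
        have t: "t \<in> P" "t \<in> span (set rs)" "refl_prod rs \<circ> refl_along t = refl_prod (a @ b)" "refl_prod rs t \<notin> P"
          using simple_list_split_pos(2,5)[OF simple_list] simple_list_delete[OF simple_list] by (simp_all add: t_def asb)
        have simple_list': "simple_list (a @ b)" by (rule simple_list_sub[OF less.prems(1)]) (use D(1) asb in auto)
        have "set qs \<subseteq> set (a @ b)" using subseq_set[OF qs(1)] s(2) asb by auto
        then have "set qs \<subseteq> span (set (a @ b))" using span_superset by blast
        then have "t \<in> span (set ks)"
          using deleted_root_in_complement[OF less.prems(1) simple_list_subseq[OF less.prems(1) qs(1)] _ _ P_all_roots[OF t(1)] t(2) simple_list' t(3)[symmetric]]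
            rs_us_ks us(2) qs(2) by simp
        then show False using pos t by blast
      qed
      then show ?thesis using sum nonempty by simp
    qed
  qed
qed

text \<open>After the sums are exchanged, the powers of z no longer depend on \<beta>. What remains
  over \<beta> is the alternating sum, which selects the subwords of rs. For these the terms (y +
  z)^k (-z)^(n - k) add up to y^n, which explains the shift from y to y + z.\<close>

lemma sum_down_powers:
  fixes y z :: "'r::comm_ring_1"
  assumes rs: "simple_list rs"
  shows "(\<Sum>\<beta>\<in>{\<beta>. abs_le W \<beta> (refl_prod rs)}. (- z) ^ (length rs - rk W \<beta>) *
      (\<Sum>\<alpha>\<in>{\<alpha> \<in> W. down\<^sup>*\<^sup>* \<alpha> \<beta>}. (y + z) ^ rk W \<alpha> * z ^ (rk W \<beta> - rk W \<alpha>))) = y ^ length rs"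
proof -
  let ?n = "length rs" and ?\<delta> = "refl_prod rs"
  have finW: "finite W" using W by (simp add: finite_reflection_group_def)
  have fin1: "finite {\<beta>. abs_le W \<beta> ?\<delta>}" by (rule finite_subset[OF _ finW]) (auto simp: abs_le_def)
  have fin2: "finite {\<alpha> \<in> W. Q \<alpha>}" for Q using finW by simp
  have rk_mono: "rk W \<alpha> \<le> rk W \<beta>" if "abs_le W \<alpha> \<beta>" for \<alpha> \<beta> using that by (simp add: abs_le_def)
  \<comment> \<open>The sign (-1)^(n - rk \<beta>) is split into (-1)^n and (-1)^(rk \<beta>), so
    that g collects all that is independent of \<beta>.\<close>
  define g where "g \<alpha> = (y + z) ^ rk W \<alpha> * z ^ (?n - rk W \<alpha>) * (- 1) ^ ?n" for \<alpha>
  have "(\<Sum>\<beta>\<in>{\<beta>. abs_le W \<beta> ?\<delta>}. (- z) ^ (?n - rk W \<beta>) *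
      (\<Sum>\<alpha>\<in>{\<alpha> \<in> W. down\<^sup>*\<^sup>* \<alpha> \<beta>}. (y + z) ^ rk W \<alpha> * z ^ (rk W \<beta> - rk W \<alpha>))) =
    (\<Sum>\<beta>\<in>{\<beta>. abs_le W \<beta> ?\<delta>}. \<Sum>\<alpha>\<in>{\<alpha> \<in> {\<alpha>. abs_le W \<alpha> ?\<delta>}. down\<^sup>*\<^sup>* \<alpha> \<beta>}. g \<alpha> * (- 1) ^ rk W \<beta>)"
    unfolding sum_distrib_left
  proof (rule sum.cong[OF refl], rule sum.cong)
    fix \<beta> assume "\<beta> \<in> {\<beta>. abs_le W \<beta> ?\<delta>}"
    then have \<beta>: "abs_le W \<beta> ?\<delta>" by simp
    have r1: "rk W \<beta> \<le> ?n" using rk_mono[OF \<beta>] rk_simple_list[OF rs] by simp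
    have "abs_le W \<alpha> ?\<delta>" if "\<alpha> \<in> W" "down\<^sup>*\<^sup>* \<alpha> \<beta>" for \<alpha>
      using abs_le_trans[OF down_rtranclp_abs_le[OF that(2,1)] \<beta>] .
    then show "{\<alpha> \<in> W. down\<^sup>*\<^sup>* \<alpha> \<beta>} = {\<alpha> \<in> {\<alpha>. abs_le W \<alpha> ?\<delta>}. down\<^sup>*\<^sup>* \<alpha> \<beta>}"
      by (auto dest: abs_le_mem)
    fix \<alpha> assume "\<alpha> \<in> {\<alpha> \<in> {\<alpha>. abs_le W \<alpha> ?\<delta>}. down\<^sup>*\<^sup>* \<alpha> \<beta>}"
    then have "down\<^sup>*\<^sup>* \<alpha> \<beta>" "\<alpha> \<in> W" by (auto dest: abs_le_mem)
    then have "abs_le W \<alpha> \<beta>" by (rule down_rtranclp_abs_le)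
    then have r2: "rk W \<alpha> \<le> rk W \<beta>" by (rule rk_mono)
    have e1: "z ^ (rk W \<beta> - rk W \<alpha>) * z ^ (?n - rk W \<beta>) = z ^ (?n - rk W \<alpha>)"
      using r1 r2 by (simp flip: power_add)
    have "(- 1 :: 'r) ^ ?n = (- 1) ^ (?n - rk W \<beta>) * (- 1) ^ rk W \<beta>"
      using r1 by (simp flip: power_add)
    then have e2: "(- 1 :: 'r) ^ (?n - rk W \<beta>) = (- 1) ^ ?n * (- 1) ^ rk W \<beta>"
      by (simp add: mult.assoc flip: power_mult_distrib)
    show "(- z) ^ (?n - rk W \<beta>) * ((y + z) ^ rk W \<alpha> * z ^ (rk W \<beta> - rk W \<alpha>)) = g \<alpha> * (- 1) ^ rk W \<beta>"
      unfolding g_def power_minus[of z] e1[symmetric] e2 by (simp only: ac_simps)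
  qed
  also have "\<dots> = (\<Sum>\<alpha>\<in>{\<alpha>. abs_le W \<alpha> ?\<delta>}. \<Sum>\<beta>\<in>{\<beta> \<in> {\<beta>. abs_le W \<beta> ?\<delta>}. down\<^sup>*\<^sup>* \<alpha> \<beta>}. g \<alpha> * (- 1) ^ rk W \<beta>)"
    by (rule sum.swap_restrict[OF fin1 fin1])
  also have "\<dots> = (\<Sum>\<alpha>\<in>{\<alpha>. abs_le W \<alpha> ?\<delta>}. if \<alpha> \<in> refl_prod ` {qs. subseq qs rs} then g \<alpha> * (- 1) ^ rk W \<alpha> else 0)"
  proof (rule sum.cong[OF refl])
    fix \<alpha> assume "\<alpha> \<in> {\<alpha>. abs_le W \<alpha> ?\<delta>}"
    then have \<alpha>: "abs_le W \<alpha> ?\<delta>" by simp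
    have "(\<Sum>\<beta>\<in>{\<beta> \<in> {\<beta>. abs_le W \<beta> ?\<delta>}. down\<^sup>*\<^sup>* \<alpha> \<beta>}. g \<alpha> * (- 1) ^ rk W \<beta>) =
      g \<alpha> * of_int (\<Sum>\<beta>\<in>{\<beta>. down\<^sup>*\<^sup>* \<alpha> \<beta> \<and> abs_le W \<beta> ?\<delta>}. (- 1) ^ rk W \<beta>)"
      unfolding sum_distrib_left[symmetric] of_int_sum by (simp add: conj_commute)
    then show "(\<Sum>\<beta>\<in>{\<beta> \<in> {\<beta>. abs_le W \<beta> ?\<delta>}. down\<^sup>*\<^sup>* \<alpha> \<beta>}. g \<alpha> * (- 1) ^ rk W \<beta>) =
      (if \<alpha> \<in> refl_prod ` {qs. subseq qs rs} then g \<alpha> * (- 1) ^ rk W \<alpha> else 0)"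
      unfolding alternating_down_sum[OF rs \<alpha>] by simp
  qed
  also have "\<dots> = (\<Sum>\<alpha>\<in>refl_prod ` {qs. subseq qs rs}. g \<alpha> * (- 1) ^ rk W \<alpha>)"
  proof -
    \<comment> \<open>Inserting the missing letters one at a time gives a chain of coverings up to
      the full word.\<close>
    have "abs_le W (refl_prod qs) ?\<delta>" if "subseq qs rs" for qs
      using that
    proof (induction "length rs - length qs" arbitrary: qs rule: less_induct)
      case less
      show ?case
      proof (cases "qs = rs")
        case True
        then show ?thesis using abs_le_refl W_I[OF simple_list_D(4)[OF rs]] by simp
      next
        case False
        then obtain a s b where asb: "qs = a @ b" "subseq (a @ s # b) rs"
          using subseq_insert_letter less.prems by blast
        have "length (a @ s # b) \<le> length rs" using asb(2) by (rule list_emb_length)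
        then have le: "abs_le W (refl_prod (a @ s # b)) ?\<delta>" using less.hyps[OF _ asb(2)] asb(1) by simp
        note simple_list = simple_list_subseq[OF rs asb(2)]
        let ?t = "refl_prod (rev b) s"
        have t: "?t \<in> all_roots" using simple_list_split_pos(2)[OF simple_list] by (rule P_all_roots)
        have "refl_prod (a @ s # b) = refl_prod (a @ b) \<circ> refl_along ?t"
          unfolding simple_list_delete(1)[OF simple_list, symmetric] by (simp add: fun_eq_iff)
        moreover have simple_list': "simple_list (a @ b)" using simple_list_subseq[OF rs less.prems] asb(1) by simp
        ultimately have "abs_le W (refl_prod (a @ b)) (refl_prod (a @ s # b))"
          using rk_refl[OF t] W_I[OF simple_list_D(4)[OF simple_list']] W_I[OF simple_list_D(4)[OF simple_list]] rk_simple_list[OF simple_list] rk_simple_list[OF simple_list']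
          by (simp add: abs_le_def W_comp_inv_left)
        then show ?thesis using le asb(1) abs_le_trans by blast
      qed
    qed
    then have "{\<alpha>. abs_le W \<alpha> ?\<delta>} \<inter> refl_prod ` {qs. subseq qs rs} = refl_prod ` {qs. subseq qs rs}" by auto
    then show ?thesis using fin1 by (simp add: sum.inter_restrict[symmetric])
  qed
  also have "\<dots> = (\<Sum>qs\<in>{qs. subseq qs rs}. g (refl_prod qs) * (- 1) ^ rk W (refl_prod qs))"
    by (rule sum.reindex_cong[OF _ refl refl]) (auto intro!: inj_onI simple_list_subseq_inj[OF rs])
  also have "\<dots> = (\<Sum>qs\<in>{qs. subseq qs rs}. (y + z) ^ length qs * (- z) ^ (?n - length qs))"
  proof (rule sum.cong[OF refl])
    fix qs assume "qs \<in> {qs. subseq qs rs}"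
    then have q: "subseq qs rs" by simp
    have rk: "rk W (refl_prod qs) = length qs" by (rule rk_simple_list[OF simple_list_subseq[OF rs q]])
    have "length qs \<le> ?n" using q by (rule list_emb_length)
    then have "(- 1 :: 'r) ^ ?n = (- 1) ^ (?n - length qs) * (- 1) ^ length qs" by (simp flip: power_add)
    then have e: "(- 1 :: 'r) ^ ?n * (- 1) ^ length qs = (- 1) ^ (?n - length qs)"
      by (simp add: mult.assoc flip: power_mult_distrib)
    show "g (refl_prod qs) * (- 1) ^ rk W (refl_prod qs) = (y + z) ^ length qs * (- z) ^ (?n - length qs)"
      unfolding g_def rk power_minus[of z] e[symmetric] by (simp only: ac_simps)
  qed
  also have "\<dots> = y ^ ?n" using sum_subseq_powers[OF simple_list_D(1)[OF rs], of "y + z" "- z"] by simp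
  finally show ?thesis .
qed

text \<open>The powers of -z multiply to one that does not depend on \<beta>, so the sum over
  \<beta> is the sum of the Moebius function over the interval from \<alpha> to \<delta>. Only
  \<alpha> = \<delta> survives.\<close>

lemma sum_mobius_powers:
  fixes y z :: "'r::comm_ring_1"
  assumes \<delta>: "\<delta> \<in> NC W c"
  shows "(\<Sum>\<beta>\<in>{\<beta> \<in> NC W c. abs_le W \<beta> \<delta>}. (- z) ^ (rk W \<delta> - rk W \<beta>) *
      (\<Sum>\<alpha>\<in>{\<alpha> \<in> NC W c. abs_le W \<alpha> \<beta>}.
        of_int (mobius (NC W c) (abs_le W) \<alpha> \<beta>) * y ^ rk W \<alpha> * (- z) ^ (rk W \<beta> - rk W \<alpha>))) = y ^ rk W \<delta>"
proof -
  let ?N = "NC W c" and ?\<mu> = "mobius (NC W c) (abs_le W)"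
  have po: "finite_poset ?N (abs_le W)" by (rule finite_poset_NC[OF W])
  then have fin: "finite {\<beta> \<in> ?N. Q \<beta>}" for Q by (simp add: finite_poset_def)
  have rk_mono: "rk W \<alpha> \<le> rk W \<beta>" if "abs_le W \<alpha> \<beta>" for \<alpha> \<beta> using that by (simp add: abs_le_def)
  define g where "g \<alpha> = y ^ rk W \<alpha> * (- z) ^ (rk W \<delta> - rk W \<alpha>)" for \<alpha>
  have "(\<Sum>\<beta>\<in>{\<beta> \<in> ?N. abs_le W \<beta> \<delta>}. (- z) ^ (rk W \<delta> - rk W \<beta>) *
      (\<Sum>\<alpha>\<in>{\<alpha> \<in> ?N. abs_le W \<alpha> \<beta>}. of_int (?\<mu> \<alpha> \<beta>) * y ^ rk W \<alpha> * (- z) ^ (rk W \<beta> - rk W \<alpha>))) =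
    (\<Sum>\<beta>\<in>{\<beta> \<in> ?N. abs_le W \<beta> \<delta>}. \<Sum>\<alpha>\<in>{\<alpha> \<in> {\<alpha> \<in> ?N. abs_le W \<alpha> \<delta>}. abs_le W \<alpha> \<beta>}. g \<alpha> * of_int (?\<mu> \<alpha> \<beta>))"
    unfolding sum_distrib_left
  proof (rule sum.cong[OF refl], rule sum.cong)
    fix \<beta> assume "\<beta> \<in> {\<beta> \<in> ?N. abs_le W \<beta> \<delta>}"
    then have \<beta>: "abs_le W \<beta> \<delta>" by simp
    show "{\<alpha> \<in> ?N. abs_le W \<alpha> \<beta>} = {\<alpha> \<in> {\<alpha> \<in> ?N. abs_le W \<alpha> \<delta>}. abs_le W \<alpha> \<beta>}"
      using abs_le_trans[OF _ \<beta>] by auto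
    fix \<alpha> assume "\<alpha> \<in> {\<alpha> \<in> {\<alpha> \<in> ?N. abs_le W \<alpha> \<delta>}. abs_le W \<alpha> \<beta>}"
    then have e: "(- z) ^ (rk W \<beta> - rk W \<alpha>) * (- z) ^ (rk W \<delta> - rk W \<beta>) = (- z) ^ (rk W \<delta> - rk W \<alpha>)"
      using rk_mono[OF \<beta>] rk_mono[of \<alpha> \<beta>] by (simp flip: power_add)
    show "(- z) ^ (rk W \<delta> - rk W \<beta>) * (of_int (?\<mu> \<alpha> \<beta>) * y ^ rk W \<alpha> * (- z) ^ (rk W \<beta> - rk W \<alpha>)) =
        g \<alpha> * of_int (?\<mu> \<alpha> \<beta>)"
      unfolding g_def e[symmetric] by (simp only: ac_simps)
  qed
  also have "\<dots> = (\<Sum>\<alpha>\<in>{\<alpha> \<in> ?N. abs_le W \<alpha> \<delta>}. \<Sum>\<beta>\<in>{\<beta> \<in> {\<beta> \<in> ?N. abs_le W \<beta> \<delta>}. abs_le W \<alpha> \<beta>}. g \<alpha> * of_int (?\<mu> \<alpha> \<beta>))"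
    by (rule sum.swap_restrict[OF fin fin])
  also have "\<dots> = (\<Sum>\<alpha>\<in>{\<alpha> \<in> ?N. abs_le W \<alpha> \<delta>}. if \<alpha> = \<delta> then g \<alpha> else 0)"
  proof (rule sum.cong[OF refl])
    fix \<alpha> assume "\<alpha> \<in> {\<alpha> \<in> ?N. abs_le W \<alpha> \<delta>}"
    then have \<alpha>: "\<alpha> \<in> ?N" "abs_le W \<alpha> \<delta>" by auto
    have eq: "{\<beta> \<in> {\<beta> \<in> ?N. abs_le W \<beta> \<delta>}. abs_le W \<alpha> \<beta>} = {\<beta> \<in> ?N. abs_le W \<alpha> \<beta> \<and> abs_le W \<beta> \<delta>}" by blast
    have "(\<Sum>\<beta>\<in>{\<beta> \<in> {\<beta> \<in> ?N. abs_le W \<beta> \<delta>}. abs_le W \<alpha> \<beta>}. g \<alpha> * of_int (?\<mu> \<alpha> \<beta>)) =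
      g \<alpha> * of_int (\<Sum>\<beta>\<in>{\<beta> \<in> ?N. abs_le W \<alpha> \<beta> \<and> abs_le W \<beta> \<delta>}. ?\<mu> \<alpha> \<beta>)"
      unfolding eq of_int_sum sum_distrib_left ..
    then show "(\<Sum>\<beta>\<in>{\<beta> \<in> {\<beta> \<in> ?N. abs_le W \<beta> \<delta>}. abs_le W \<alpha> \<beta>}. g \<alpha> * of_int (?\<mu> \<alpha> \<beta>)) =
      (if \<alpha> = \<delta> then g \<alpha> else 0)"
      unfolding mobius_sum[where le = "abs_le W", OF po \<alpha>(1) \<delta> \<alpha>(2)] by simp
  qed
  also have "\<dots> = g \<delta>"
  proof -
    have "\<delta> \<in> {\<alpha> \<in> ?N. abs_le W \<alpha> \<delta>}" using \<delta> abs_le_refl by (simp add: NC_def)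
    then show ?thesis using fin by (simp only: sum.delta if_True)
  qed
  also have "\<dots> = y ^ rk W \<delta>" by (simp add: g_def)
  finally show ?thesis .
qed

text \<open>Both rows satisfy the same recursion: their weighted sum over everything below \<delta>
  is \<open>y ^ rk W \<delta>\<close>. The row of \<delta> itself has weight (-z)^0 = 1, so the
  lower rows determine it without any division in the ring.\<close>

lemma mobius_row_eq_down_row:
  fixes y z :: "'r::comm_ring_1"
  assumes cs: "simple_list cs" and \<delta>: "\<delta> \<in> NC W (refl_prod cs)"
  shows "(\<Sum>\<alpha>\<in>{\<alpha> \<in> NC W (refl_prod cs). abs_le W \<alpha> \<delta>}.
      of_int (mobius (NC W (refl_prod cs)) (abs_le W) \<alpha> \<delta>) * y ^ rk W \<alpha> * (- z) ^ (rk W \<delta> - rk W \<alpha>)) =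
    (\<Sum>\<alpha>\<in>{\<alpha> \<in> W. down\<^sup>*\<^sup>* \<alpha> \<delta>}. (y + z) ^ rk W \<alpha> * z ^ (rk W \<delta> - rk W \<alpha>))"
    (is "?M \<delta> = ?I \<delta>")
  using \<delta>
proof (induction "rk W \<delta>" arbitrary: \<delta> rule: less_induct)
  case less
  let ?N = "NC W (refl_prod cs)"
  have \<delta>: "\<delta> \<in> W" "abs_le W \<delta> (refl_prod cs)" using less.prems by (auto simp: NC_def)
  obtain rs where rs: "simple_list rs" "refl_prod rs = \<delta>" using abs_le_simple_list[OF \<delta>(2) cs] by blast
  have below: "{\<beta>. abs_le W \<beta> \<delta>} = {\<beta> \<in> ?N. abs_le W \<beta> \<delta>}"
    using abs_le_trans[OF _ \<delta>(2)] by (auto simp: NC_def dest: abs_le_mem)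
  have finN: "finite ?N" using finite_poset_NC[OF W] by (simp add: finite_poset_def)
  define B where "B = {\<beta> \<in> ?N. abs_le W \<beta> \<delta> \<and> \<beta> \<noteq> \<delta>}"
  have B: "{\<beta> \<in> ?N. abs_le W \<beta> \<delta>} = insert \<delta> B" "\<delta> \<notin> B" "finite B"
    using less.prems abs_le_refl[OF \<delta>(1)] finN by (auto simp: B_def)
  have MI: "?M \<beta> = ?I \<beta>" if "\<beta> \<in> B" for \<beta>
  proof (rule less.hyps)
    show "\<beta> \<in> ?N" using that by (simp add: B_def)
    have b: "abs_le W \<beta> \<delta>" "\<beta> \<noteq> \<delta>" "\<beta> \<in> W" using that by (auto simp: B_def NC_def)
    have "rk W (inv \<beta> \<circ> \<delta>) \<noteq> 0"
    proof
      assume "rk W (inv \<beta> \<circ> \<delta>) = 0"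
      then have "inv \<beta> \<circ> \<delta> = id" using rk_eq_0[OF W] b \<delta> group_closed[OF W] by simp
      then show False using b W_comp_inv_left(2)[OF b(3), of \<delta>] by simp
    qed
    then show "rk W \<beta> < rk W \<delta>" using b(1) by (simp add: abs_le_def)
  qed
  have "(\<Sum>\<beta>\<in>insert \<delta> B. (- z) ^ (rk W \<delta> - rk W \<beta>) * ?M \<beta>) = y ^ rk W \<delta>"
    using sum_mobius_powers[OF less.prems, of z y] unfolding B(1) .
  then have 1: "?M \<delta> + (\<Sum>\<beta>\<in>B. (- z) ^ (rk W \<delta> - rk W \<beta>) * ?M \<beta>) = y ^ rk W \<delta>"
    unfolding sum.insert[OF B(3,2)] by simp
  have "(\<Sum>\<beta>\<in>insert \<delta> B. (- z) ^ (rk W \<delta> - rk W \<beta>) * ?I \<beta>) = y ^ rk W \<delta>"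
    using sum_down_powers[OF rs(1), of z y] unfolding rs(2) below B(1) rk_simple_list[OF rs(1), symmetric, unfolded rs(2)] .
  then have 2: "?I \<delta> + (\<Sum>\<beta>\<in>B. (- z) ^ (rk W \<delta> - rk W \<beta>) * ?I \<beta>) = y ^ rk W \<delta>"
    unfolding sum.insert[OF B(3,2)] by simp
  have "(\<Sum>\<beta>\<in>B. (- z) ^ (rk W \<delta> - rk W \<beta>) * ?M \<beta>) = (\<Sum>\<beta>\<in>B. (- z) ^ (rk W \<delta> - rk W \<beta>) * ?I \<beta>)"
    using MI by (intro sum.cong) simp_all
  then have "?M \<delta> + (\<Sum>\<beta>\<in>B. (- z) ^ (rk W \<delta> - rk W \<beta>) * ?I \<beta>) =
      ?I \<delta> + (\<Sum>\<beta>\<in>B. (- z) ^ (rk W \<delta> - rk W \<beta>) * ?I \<beta>)"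
    using 1 2 by simp
  then show ?case by (rule add_right_imp_eq)
qed

section \<open>Assembling the polynomials\<close>

lemma M_poly_eq_I_poly:
  fixes x :: "('a \<Rightarrow> 'a) \<Rightarrow> 'r::comm_ring_1"
  assumes cs: "simple_list cs"
  shows "M_poly W (refl_along ` \<Delta>) (refl_prod cs) x y z = I_poly W (refl_along ` \<Delta>) (refl_prod cs) x (y + z) z"
proof -
  let ?N = "NC W (refl_prod cs)" and ?X = "\<lambda>\<beta>. \<Prod>s\<in>refl_along ` \<Delta> - supp (refl_along ` \<Delta>) \<beta>. x s"
  have finN: "finite ?N" using finite_poset_NC[OF W] by (simp add: finite_poset_def)
  have "M_poly W (refl_along ` \<Delta>) (refl_prod cs) x y z = (\<Sum>\<beta>\<in>?N. ?X \<beta> * (\<Sum>\<alpha>\<in>{\<alpha> \<in> ?N. abs_le W \<alpha> \<beta>}.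
      of_int (mobius ?N (abs_le W) \<alpha> \<beta>) * y ^ rk W \<alpha> * (- z) ^ (rk W \<beta> - rk W \<alpha>)))"
    unfolding M_poly_def sum_related_pairs[OF finN] sum_distrib_left
    by (intro sum.cong refl) (simp add: ac_simps)
  also have "\<dots> = (\<Sum>\<beta>\<in>?N. ?X \<beta> * (\<Sum>\<alpha>\<in>{\<alpha> \<in> W. down\<^sup>*\<^sup>* \<alpha> \<beta>}. (y + z) ^ rk W \<alpha> * z ^ (rk W \<beta> - rk W \<alpha>)))"
    by (intro sum.cong refl) (simp only: mobius_row_eq_down_row[OF cs])
  \<comment> \<open>Steps of \<open>down\<close> go up in the absolute order, so every \<alpha> that
    reaches \<beta> is noncrossing as well.\<close>
  also have "\<dots> = (\<Sum>\<beta>\<in>?N. ?X \<beta> * (\<Sum>\<alpha>\<in>{\<alpha> \<in> ?N. down\<^sup>*\<^sup>* \<alpha> \<beta>}. (y + z) ^ rk W \<alpha> * z ^ (rk W \<beta> - rk W \<alpha>)))"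
  proof (rule sum.cong[OF refl])
    fix \<beta> assume "\<beta> \<in> ?N"
    then have \<beta>: "abs_le W \<beta> (refl_prod cs)" by (simp add: NC_def)
    have "abs_le W \<alpha> (refl_prod cs)" if "\<alpha> \<in> W" "down\<^sup>*\<^sup>* \<alpha> \<beta>" for \<alpha>
      using abs_le_trans[OF down_rtranclp_abs_le[OF that(2,1)] \<beta>] .
    then have "{\<alpha> \<in> W. down\<^sup>*\<^sup>* \<alpha> \<beta>} = {\<alpha> \<in> ?N. down\<^sup>*\<^sup>* \<alpha> \<beta>}"
      by (auto simp: NC_def)
    then show "?X \<beta> * (\<Sum>\<alpha>\<in>{\<alpha> \<in> W. down\<^sup>*\<^sup>* \<alpha> \<beta>}. (y + z) ^ rk W \<alpha> * z ^ (rk W \<beta> - rk W \<alpha>)) =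
      ?X \<beta> * (\<Sum>\<alpha>\<in>{\<alpha> \<in> ?N. down\<^sup>*\<^sup>* \<alpha> \<beta>}. (y + z) ^ rk W \<alpha> * z ^ (rk W \<beta> - rk W \<alpha>))" by simp
  qed
  also have "\<dots> = I_poly W (refl_along ` \<Delta>) (refl_prod cs) x (y + z) z"
    unfolding I_poly_def ll_down sum_related_pairs[OF finN] sum_distrib_left
    by (intro sum.cong refl) (simp add: ac_simps)
  finally show ?thesis .
qed

text \<open>A reflection has only one positive unit root, so a word using each simple reflection
  once lifts to an ordering of \<Delta>.\<close>

lemma standard_coxeter_refl_prod:
  assumes "standard_coxeter (refl_along ` \<Delta>) c"
  obtains cs where "simple_list cs" "c = refl_prod cs"
proof -
  obtain ws where ws: "distinct ws" "set ws = refl_along ` \<Delta>" "c = word_prod ws"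
    using assms by (auto simp: standard_coxeter_def)
  have inj: "inj_on refl_along \<Delta>"
  proof (rule inj_onI)
    fix a b assume ab: "a \<in> \<Delta>" "b \<in> \<Delta>" "refl_along a = refl_along b"
    then have "a \<in> P" "b \<in> P" using \<Delta>_P by auto
    then show "a = b" using ab(3) refl_along_eq_iff[of a b] unit neg by auto
  qed
  have "ws \<in> lists (refl_along ` \<Delta>)" using ws(2) by auto
  then obtain cs where cs: "ws = map refl_along cs" "set cs \<subseteq> \<Delta>" by (auto simp: lists_image)
  have "refl_along ` set cs = refl_along ` \<Delta>" using ws(2) cs(1) by simp
  then have "set cs = \<Delta>" using inj cs(2) by (metis inj_on_image_eq_iff order_refl)
  moreover have "distinct cs" using ws(1) cs(1) by (simp add: distinct_map)
  ultimately show thesis using that[OF simple_list_\<Delta>] ws(3) cs(1) by (simp add: refl_prod_def)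
qed

end

theorem theorem9p2:
  fixes W S :: "('a::euclidean_space \<Rightarrow> 'a) set"
    and c :: "'a \<Rightarrow> 'a"
    and x :: "('a \<Rightarrow> 'a) \<Rightarrow> 'r::comm_ring_1"
    and y z :: 'r
  assumes "finite_reflection_group W"
    and "simple_system W S"
    and "standard_coxeter S c"
  shows "M_poly W S c x y z = I_poly W S c x (y + z) z"
proof -
  obtain \<Delta> where simple: "simple_roots W \<Delta>" "S = refl_along ` \<Delta>"
    using assms(2) by (auto simp: simple_system_def)
  interpret coxeter_group W \<Delta> by standard (rule assms(1), rule simple(1))
  obtain cs where "simple_list cs" "c = refl_prod cs" using standard_coxeter_refl_prod assms(3) simple(2) by metis
  then show ?thesis using M_poly_eq_I_poly simple(2) by simp
qed

end
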